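(* Let $A$ and $B$ be real square matrices, of sizes $n\times n$ and $m\times m$, that are diagonalizable over $\mathbb{C}$ and all of whose eigenvalues have positive real part, so that $G(A)$ and $G(B)$ are Heintze groups of Abelian type. Then the horospherical product $G(A)\bowtie G(B)$ has volume entropy $$\delta(G(A)\bowtie G(B))=\max\big(\delta(G(A)),\,\delta(G(B))\big),$$ where $\delta(G(A))=\operatorname{tr}(J_A)$ and $\delta(G(B))=\operatorname{tr}(J_B)$, with $J_A$, $J_B$ the complex Jordan forms of $A$ and $B$.
   Context: For a real $k\times k$ matrix $C$, $G(C)=\mathbb{R}^k\rtimes_C\mathbb{R}$ is the Lie group with underlying manifold $\mathbb{R}^k\times\mathbb{R}$ and product $(x,t)*(x',t')=(x+\exp(tC)x',\,t+t')$. The horospherical product is $G(A)\bowtie G(B)=(\mathbb{R}^n\times\mathbb{R}^m)\rtimes_{\operatorname{diag}(A,-B)}\mathbb{R}=G(\operatorname{diag}(A,-B))$, where $\operatorname{diag}(A,-B)$ is the block-diagonal matrix with blocks $A$ and $-B$. Each group $G(C)$ considered (with $C=A$, $B$ or $\operatorname{diag}(A,-B)$) carries a left-invariant Riemannian metric determined by an inner product on its Lie algebra $\mathbb{R}^k\oplus\mathbb{R}\partial_t$ for which $\partial_t$ is a unit vector orthogonal to $\mathbb{R}^k$ and for which a basis of $\mathbb{R}^k$ putting $C$ in real Jordan block-diagonal form (blocks $(\alpha)$ and $\begin{pmatrix}\alpha&-\beta\\ \beta&\alpha\end{pmatrix}$) is orthonormal. The volume entropy of a homogeneous Riemannian manifold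 is $\delta=\lim_{r\to\infty}\frac{\log\operatorname{Vol}(B(x,r))}{r}$, where $B(x,r)$ is the geodesic ball of center $x$ and radius $r$ (independent of $x$ by homogeneity). *)

theory Defs
  imports "HOL-Analysis.Analysis"
begin

section \<open>Linear algebra\<close>

abbreviation complexify :: "real^'n^'n \<Rightarrow> complex^'n^'n" where
  "complexify A \<equiv> map_matrix complex_of_real A"

definition diagonalizable_over_complex :: "real^'n^'n \<Rightarrow> bool" where
  "diagonalizable_over_complex A \<longleftrightarrow>
     (\<exists>P D :: complex^'n^'n. invertible P \<and> (\<forall>i j. i \<noteq> j \<longrightarrow> D $ i $ j = 0)
        \<and> complexify A = P ** D ** matrix_inv P)"

definition complex_eigenvalue :: "real^'n^'n \<Rightarrow> complex \<Rightarrow> bool" where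
  "complex_eigenvalue A z \<longleftrightarrow> (\<exists>v. v \<noteq> 0 \<and> complexify A *v v = z *s v)"

text \<open>The index type carries no order, so a Jordan matrix is one that is upper bidiagonal, with
  superdiagonal entries 0 or 1 and constant diagonal along every run of 1s, for some enumeration
  \<open>f\<close> of the indices.\<close>

definition jordan_matrix :: "complex^'n^'n \<Rightarrow> bool" where
  "jordan_matrix J \<longleftrightarrow>
     (\<exists>f. bij_betw f {..<CARD('n)} (UNIV :: 'n set) \<and>
        (\<forall>i<CARD('n). \<forall>j<CARD('n).
           (j \<noteq> i \<and> j \<noteq> Suc i \<longrightarrow> J $ f i $ f j = 0) \<and>
           (j = Suc i \<longrightarrow> J $ f i $ f j = 0 \<or>
              (J $ f i $ f j = 1 \<and> J $ f i $ f i = J $ f j $ f j))))"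

definition complex_jordan_form_of :: "real^'n^'n \<Rightarrow> complex^'n^'n \<Rightarrow> bool" where
  "complex_jordan_form_of A J \<longleftrightarrow>
     jordan_matrix J \<and> (\<exists>P :: complex^'n^'n. invertible P \<and> complexify A = P ** J ** matrix_inv P)"

text \<open>Block-diagonal with blocks \<open>(\<alpha>)\<close> and
  \<open>((\<alpha>, - \<beta>), (\<beta>, \<alpha>))\<close>, up to the order of the indices: the involution
  \<open>\<sigma>\<close> fixes the indices of the 1x1 blocks and swaps the two indices of each 2x2 block.\<close>

definition real_jordan_block_diagonal :: "real^'k^'k \<Rightarrow> bool" where
  "real_jordan_block_diagonal D \<longleftrightarrow>
     (\<exists>\<sigma>. (\<forall>i. \<sigma> (\<sigma> i) = i) \<and>
        (\<forall>i j. j \<noteq> i \<and> j \<noteq> \<sigma> i \<longrightarrow> D $ i $ j = 0) \<and>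
        (\<forall>i. \<sigma> i \<noteq> i \<longrightarrow>
           D $ \<sigma> i $ \<sigma> i = D $ i $ i \<and> D $ \<sigma> i $ i = - D $ i $ \<sigma> i))"

definition block_diag :: "real^'n^'n \<Rightarrow> real^'m^'m \<Rightarrow> real^('n + 'm)^('n + 'm)" where
  "block_diag A B = (\<chi> i j. case (i, j) of
      (Inl a, Inl b) \<Rightarrow> A $ a $ b
    | (Inr a, Inr b) \<Rightarrow> B $ a $ b
    | _ \<Rightarrow> 0)"

definition matrix_exp :: "real^'k^'k \<Rightarrow> real^'k^'k" where
  "matrix_exp M = (\<Sum>n. (1 / fact n) *\<^sub>R (((**) M) ^^ n) (mat 1))"

definition inner_product :: "('v::real_vector \<Rightarrow> 'v \<Rightarrow> real) \<Rightarrow> bool" where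
  "inner_product ip \<longleftrightarrow>
     (\<forall>u. linear (ip u)) \<and> (\<forall>u v. ip u v = ip v u) \<and> (\<forall>u. u \<noteq> 0 \<longrightarrow> ip u u > 0)"


section \<open>Riemannian geometry of $\mathbb{R}^k \times \mathbb{R}$ in the global chart\<close>

text \<open>\<open>g p\<close> is the bilinear form on the tangent space at \<open>p\<close>.\<close>

type_synonym 'k metric_field =
  "(real^'k) \<times> real \<Rightarrow> (real^'k) \<times> real \<Rightarrow> (real^'k) \<times> real \<Rightarrow> real"

text \<open>The library's piecewise C1 curves may have unbounded derivative near the break points;
  requiring the speed to be integrable discards exactly those of infinite length.\<close>

definition has_length :: "'k::finite metric_field \<Rightarrow> (real \<Rightarrow> (real^'k) \<times> real) \<Rightarrow> real \<Rightarrow> bool" where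
  "has_length g \<gamma> L \<longleftrightarrow>
     ((\<lambda>s. sqrt (g (\<gamma> s) (vector_derivative \<gamma> (at s)) (vector_derivative \<gamma> (at s))))
        has_integral L) {0..1}"

definition riem_dist :: "'k::finite metric_field \<Rightarrow> (real^'k) \<times> real \<Rightarrow> (real^'k) \<times> real \<Rightarrow> real" where
  "riem_dist g p q = Inf {L. \<exists>\<gamma>. \<gamma> piecewise_C1_differentiable_on {0..1} \<and>
      pathstart \<gamma> = p \<and> pathfinish \<gamma> = q \<and> has_length g \<gamma> L}"

definition riem_ball :: "'k::finite metric_field \<Rightarrow> (real^'k) \<times> real \<Rightarrow> real \<Rightarrow> ((real^'k) \<times> real) set" where
  "riem_ball g p r = {q. riem_dist g p q < r}"

definition coord_vector :: "'k option \<Rightarrow> (real^'k) \<times> real" where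
  "coord_vector i = (case i of None \<Rightarrow> (0, 1) | Some a \<Rightarrow> (axis a 1, 0))"

definition gram_matrix :: "'k::finite metric_field \<Rightarrow> (real^'k) \<times> real \<Rightarrow> real^('k option)^('k option)" where
  "gram_matrix g p = (\<chi> i j. g p (coord_vector i) (coord_vector j))"

definition riem_volume :: "'k::finite metric_field \<Rightarrow> ((real^'k) \<times> real) measure" where
  "riem_volume g = density lborel (\<lambda>p. ennreal (sqrt (det (gram_matrix g p))))"

definition has_volume_entropy :: "'k::finite metric_field \<Rightarrow> real \<Rightarrow> bool" where
  "has_volume_entropy g \<delta> \<longleftrightarrow>
     (\<forall>x. ((\<lambda>r. ln (measure (riem_volume g) (riem_ball g x r)) / r) \<longlongrightarrow> \<delta>) at_top)"

definition volume_entropy :: "'k::finite metric_field \<Rightarrow> real" where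
  "volume_entropy g = (THE \<delta>. has_volume_entropy g \<delta>)"


section \<open>The groups $G(C) = \mathbb{R}^k \rtimes_C \mathbb{R}$ and their metrics\<close>

definition G_mult :: "real^'k^'k \<Rightarrow> (real^'k) \<times> real \<Rightarrow> (real^'k) \<times> real \<Rightarrow> (real^'k) \<times> real" where
  "G_mult C p q = (fst p + matrix_exp (snd p *\<^sub>R C) *v fst q, snd p + snd q)"

definition left_invariant :: "real^'k^'k \<Rightarrow> 'k::finite metric_field \<Rightarrow> bool" where
  "left_invariant C g \<longleftrightarrow>
     (\<forall>p q u v. g (G_mult C p q) (frechet_derivative (G_mult C p) (at q) u)
                                  (frechet_derivative (G_mult C p) (at q) v) = g q u v)"

text \<open>An inner product on the Lie algebra, which is the tangent space at the identity \<open>(0, 0)\<close>.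
  The columns of \<open>P\<close> are the basis vectors putting \<open>C\<close> in real Jordan form.\<close>

definition adapted_inner_product ::
    "real^'k^'k \<Rightarrow> ((real^'k) \<times> real \<Rightarrow> (real^'k) \<times> real \<Rightarrow> real) \<Rightarrow> bool" where
  "adapted_inner_product C ip \<longleftrightarrow>
     inner_product ip \<and> ip (0, 1) (0, 1) = 1 \<and> (\<forall>v. ip (0, 1) (v, 0) = 0) \<and>
     (\<exists>P :: real^'k^'k. invertible P \<and> real_jordan_block_diagonal (matrix_inv P ** C ** P) \<and>
        (\<forall>i j. ip (column i P, 0) (column j P, 0) = (if i = j then 1 else 0)))"

text \<open>Left-invariance determines \<open>g\<close> from its value at the identity, so that \<open>g\<close> is
  smooth and an inner product at every point.\<close>

definition adapted_metric :: "real^'k^'k \<Rightarrow> 'k::finite metric_field \<Rightarrow> bool" where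
  "adapted_metric C g \<longleftrightarrow> left_invariant C g \<and> adapted_inner_product C (g (0, 0))"

text \<open>The horospherical product of \<open>G(A)\<close> and \<open>G(B)\<close> is \<open>G(C)\<close> for
  this matrix \<open>C\<close>.\<close>

definition horospherical_matrix :: "real^'n^'n \<Rightarrow> real^'m^'m \<Rightarrow> real^('n + 'm)^('n + 'm)" where
  "horospherical_matrix A B = block_diag A (- B)"

end

theory Submission
  imports Defs
begin

text \<open>In the coordinates \<open>z = P\<^sup>-\<^sup>1 x\<close> of an adapted basis the rotational parts of the blocks are
  isometries, so the metric of \<open>G(C)\<close> is \<open>dt\<^sup>2 + \<Sum>\<^sub>i exp (-2 l\<^sub>i t) dz\<^sub>i\<^sup>2\<close>,
  where \<open>l\<^sub>i\<close> are the real parts of the eigenvalues, and the volume form is a multiple of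
  \<open>exp (- t \<Sum>\<^sub>i l\<^sub>i) dz dt\<close>.
  Let \<open>h\<^sub>+\<close> and \<open>h\<^sub>-\<close> be the sums of the positive and of the negated negative \<open>l\<^sub>i\<close>. A curve of length
  \<open>L\<close> from the origin whose height ranges over \<open>[-m, M]\<close> satisfies \<open>M + m \<le> L\<close>, and displaces
  \<open>z\<^sub>i\<close> by at most \<open>L exp (l\<^sub>i M)\<close> or \<open>L exp (- l\<^sub>i m)\<close>; weighting by the density at the final
  height \<open>t\<close>, such endpoints contribute at most a polynomial times
  \<open>exp (h\<^sub>+ (M - t) + h\<^sub>- (m + t))\<close>, hence the ball has volume at most a polynomial times
  \<open>exp (max h\<^sub>+ h\<^sub>- L)\<close>. Conversely, the part of the ball at height about \<open>-L\<close> has volume of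
  order \<open>exp (h\<^sub>+ L)\<close>, and the part at height about \<open>L\<close> has volume of order \<open>exp (h\<^sub>- L)\<close>.
  So the entropy is \<open>max h\<^sub>+ h\<^sub>-\<close>. For \<open>G(A)\<close> all \<open>l\<^sub>i\<close> are positive; for \<open>diag(A, -B)\<close> every
  adapted basis splits along the two summands, and \<open>h\<^sub>+ = tr A\<close>, \<open>h\<^sub>- = tr B\<close>.\<close>

section \<open>Path lengths\<close>

definition path_lengths :: "'k::finite metric_field \<Rightarrow> (real^'k) \<times> real \<Rightarrow> (real^'k) \<times> real \<Rightarrow> real set" where
  "path_lengths g p q = {L. \<exists>\<gamma>. valid_path \<gamma> \<and> pathstart \<gamma> = p \<and> pathfinish \<gamma> = q \<and> has_length g \<gamma> L}"

lemma riem_dist_eq_Inf_path_lengths: "riem_dist g p q = Inf (path_lengths g p q)"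
  by (simp add: riem_dist_def path_lengths_def valid_path_def)

text \<open>Each half of the joined path runs at double speed. Homogeneity of degree two of
  \<open>g\<close> turns this into a factor 2 in the integrand, which the substitution on an
  interval of half the length cancels.\<close>

lemma has_length_joinpaths:
  assumes hom: "\<And>p c u. g p (c *\<^sub>R u) (c *\<^sub>R u) = c\<^sup>2 * g p u u"
    and g1: "valid_path \<gamma>1" "has_length g \<gamma>1 L1"
    and g2: "valid_path \<gamma>2" "has_length g \<gamma>2 L2"
  shows "has_length g (\<gamma>1 +++ \<gamma>2) (L1 + L2)"
proof -
  define f where "f \<gamma> s = sqrt (g (\<gamma> s) (vector_derivative \<gamma> (at s)) (vector_derivative \<gamma> (at s)))" for \<gamma> s
  obtain S1 S2
    where S1: "finite S1" "\<forall>x\<in>{0..1} - S1. \<gamma>1 differentiable at x"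
      and S2: "finite S2" "\<forall>x\<in>{0..1} - S2. \<gamma>2 differentiable at x"
    using g1(1) g2(1) by (auto simp: valid_path_def piecewise_C1_differentiable_on_def C1_differentiable_on_eq)
  have 1: "(f \<gamma>1 has_integral L1) {0..1}" and 2: "(f \<gamma>2 has_integral L2) {0..1}"
    using g1 g2 by (auto simp: has_length_def f_def[abs_def])
  have i1: "((\<lambda>x. 2 * f \<gamma>1 (2*x)) has_integral L1) {0..1/2}"
   and i2: "((\<lambda>x. 2 * f \<gamma>2 (2*x - 1)) has_integral L2) {1/2..1}"
    using has_integral_affinity01 [OF 1, where m= 2 and c=0, THEN has_integral_cmul [where c=2]]
          has_integral_affinity01 [OF 2, where m= 2 and c="-1", THEN has_integral_cmul [where c=2]]
    by (simp_all only: image_affinity_atLeastAtMost_div_diff, simp_all add: mult_ac)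
  have d1: "vector_derivative (\<gamma>1 +++ \<gamma>2) (at z) = 2 *\<^sub>R vector_derivative \<gamma>1 (at (2*z))"
    if "0 \<le> z" "z*2 < 1" "2*z \<notin> S1" for z
  proof (rule vector_derivative_at [OF has_vector_derivative_transform_within])
    show "0 < \<bar>z - 1/2\<bar>"
      using that by auto
    have "((*) 2 has_vector_derivative 2) (at z)"
      by (simp add: has_vector_derivative_def has_derivative_def bounded_linear_mult_left)
    moreover have "(\<gamma>1 has_vector_derivative vector_derivative \<gamma>1 (at (2 * z))) (at (2 * z))"
      using S1 that by (auto simp: vector_derivative_works)
    ultimately
    show "((\<lambda>x. \<gamma>1 (2 * x)) has_vector_derivative 2 *\<^sub>R vector_derivative \<gamma>1 (at (2 * z))) (at z)"
      by (intro vector_diff_chain_at [simplified o_def])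
  qed (use that in \<open>simp_all add: joinpaths_def dist_real_def abs_if split: if_split_asm\<close>)
  have d2: "vector_derivative (\<gamma>1 +++ \<gamma>2) (at z) = 2 *\<^sub>R vector_derivative \<gamma>2 (at (2*z - 1))"
    if "1 < z*2" "z \<le> 1" "2*z - 1 \<notin> S2" for z
  proof (rule vector_derivative_at [OF has_vector_derivative_transform_within])
    show "0 < \<bar>z - 1/2\<bar>"
      using that by auto
    have "((\<lambda>x. 2 * x - 1) has_vector_derivative 2) (at z)"
      by (simp add: has_vector_derivative_def has_derivative_def bounded_linear_mult_left)
    moreover have "(\<gamma>2 has_vector_derivative vector_derivative \<gamma>2 (at (2 * z - 1))) (at (2 * z - 1))"
      using S2 that by (auto simp: vector_derivative_works)
    ultimately
    show "((\<lambda>x. \<gamma>2 (2 * x - 1)) has_vector_derivative 2 *\<^sub>R vector_derivative \<gamma>2 (at (2 * z - 1))) (at z)"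
      by (intro vector_diff_chain_at [simplified o_def])
  qed (use that in \<open>simp_all add: joinpaths_def dist_real_def abs_if split: if_split_asm\<close>)
  have sq: "sqrt (g p (2 *\<^sub>R u) (2 *\<^sub>R u)) = 2 * sqrt (g p u u)" for p u
    by (simp add: hom real_sqrt_mult)
  have jl: "(\<gamma>1 +++ \<gamma>2) z = \<gamma>1 (2*z)" if "z*2 \<le> 1" for z
    using that by (simp add: joinpaths_def)
  have jr: "(\<gamma>1 +++ \<gamma>2) z = \<gamma>2 (2*z - 1)" if "z*2 > 1" for z
    using that by (simp add: joinpaths_def)
  \<comment> \<open>The chain rule is available away from the joint 1/2 and the preimages of the
    break points, a finite set that does not affect the integral.\<close>
  have "(f (\<gamma>1 +++ \<gamma>2) has_integral L1) {0..1/2}"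
    by (rule has_integral_spike_finite [OF _ _ i1, of "insert (1/2) ((*)2 -` S1)"])
       (auto simp: f_def d1 sq jl intro!: finite_vimageI S1 injI)
  moreover have "(f (\<gamma>1 +++ \<gamma>2) has_integral L2) {1/2..1}"
    by (rule has_integral_spike_finite [OF _ _ i2, of "insert (1/2) ((\<lambda>x. 2*x-1) -` S2)"])
       (auto simp: f_def d2 sq jr intro!: finite_vimageI S2 injI)
  ultimately show ?thesis
    using has_integral_combine[of 0 "1/2" 1 "f (\<gamma>1 +++ \<gamma>2)" L1 L2]
    by (simp add: has_length_def f_def[abs_def])
qed

text \<open>The normal form in the coordinates z = N x. Distances and volumes are estimated from
  this form alone; the group law enters only when a left-invariant metric is brought to it.\<close>

locale warped_metric =
  fixes g :: "'k::finite metric_field" and l :: "'k \<Rightarrow> real" and N P :: "real^'k^'k"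
  assumes NP: "N ** P = mat 1"
    and metric: "\<And>p u v. g p u v =
      snd u * snd v + (\<Sum>i\<in>UNIV. exp (- 2 * l i * snd p) * (N *v fst u) $ i * (N *v fst v) $ i)"
begin

lemma PN: "P ** N = mat 1"
  using NP matrix_left_right_inverse by blast

lemma N_P_vec [simp]: "N *v (P *v x) = x" and P_N_vec [simp]: "P *v (N *v x) = x"
  by (simp_all add: matrix_vector_mul_assoc NP PN)

definition hor_norm :: "real \<Rightarrow> real^'k \<Rightarrow> real" where
  "hor_norm t v = sqrt (\<Sum>i\<in>UNIV. (exp (- l i * t) * (N *v v) $ i)\<^sup>2)"

lemma metric_self: "g p u u = (snd u)\<^sup>2 + (hor_norm (snd p) (fst u))\<^sup>2"
proof -
  have "exp (- 2 * l i * snd p) = (exp (- l i * snd p))\<^sup>2" for i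
    by (simp add: exp_double [symmetric] algebra_simps)
  then show ?thesis
    unfolding metric hor_norm_def
    by (simp add: sum_nonneg power_mult_distrib) (simp add: power2_eq_square mult.assoc)
qed

lemma metric_nonneg: "g p u u \<ge> 0"
  by (simp add: metric_self)

lemma metric_scaleR: "g p (c *\<^sub>R u) (c *\<^sub>R u) = c\<^sup>2 * g p u u"
  by (simp add: metric matrix_vector_mult_scaleR power2_eq_square sum_distrib_left algebra_simps)

lemma hor_norm_le_sum: "hor_norm t v \<le> (\<Sum>i\<in>UNIV. exp (- l i * t) * \<bar>(N *v v) $ i\<bar>)"
  unfolding hor_norm_def
  by (rule order_trans[OF L2_set_le_sum_abs[unfolded L2_set_def]]) (simp add: abs_mult)

lemma component_le_hor_norm: "exp (- l i * t) * \<bar>(N *v v) $ i\<bar> \<le> hor_norm t v"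
proof -
  have "\<bar>exp (- l i * t) * (N *v v) $ i\<bar> \<le> hor_norm t v"
    unfolding hor_norm_def real_sqrt_abs[symmetric]
    by (rule real_sqrt_le_mono) (rule member_le_sum, auto)
  then show ?thesis by (simp add: abs_mult)
qed

lemma hor_norm_nonneg: "hor_norm t v \<ge> 0"
  by (simp add: hor_norm_def sum_nonneg)

section \<open>Distances: concatenation of paths and lower bounds for lengths\<close>

lemma has_length_nonneg: "has_length g \<gamma> L \<Longrightarrow> L \<ge> 0"
  unfolding has_length_def by (rule has_integral_nonneg) (auto simp: metric_nonneg)

lemma path_lengths_bdd_below: "bdd_below (path_lengths g p q)"
  by (auto simp: path_lengths_def bdd_below_def intro: has_length_nonneg)

lemma path_lengths_trans:
  assumes "L1 \<in> path_lengths g p q" "L2 \<in> path_lengths g q w"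
  shows "L1 + L2 \<in> path_lengths g p w"
proof -
  obtain \<gamma>1 \<gamma>2 where "valid_path \<gamma>1" "pathstart \<gamma>1 = p" "pathfinish \<gamma>1 = q" "has_length g \<gamma>1 L1"
    "valid_path \<gamma>2" "pathstart \<gamma>2 = q" "pathfinish \<gamma>2 = w" "has_length g \<gamma>2 L2"
    using assms by (auto simp: path_lengths_def)
  then show ?thesis
    unfolding path_lengths_def
    by (auto intro!: exI[of _ "\<gamma>1 +++ \<gamma>2"] valid_path_join has_length_joinpaths metric_scaleR)
qed

text \<open>Constant speed makes the length integral trivial. Vertical segments and segments at a
  fixed height both qualify, and together they join any two points.\<close>

lemma has_length_linepath:
  assumes "\<And>s. g (linepath p q s) (q - p) (q - p) = c\<^sup>2" "c \<ge> 0"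
  shows "c \<in> path_lengths g p q"
proof -
  have "has_length g (linepath p q) c"
    using assms has_integral_const_real[of c 0 1] by (simp add: has_length_def)
  moreover have "valid_path (linepath p q)"
    unfolding valid_path_def linepath_def C1_differentiable_on_def piecewise_C1_differentiable_on_def
    by (auto intro!: continuous_intros exI[of _ "{}"] exI[of _ "\<lambda>_. q - p"] derivative_eq_intros
        simp: algebra_simps)
  ultimately show ?thesis
    by (auto simp: path_lengths_def)
qed

lemma path_lengths_vertical: "\<bar>t' - t\<bar> \<in> path_lengths g (x, t) (x, t')"
  by (rule has_length_linepath) (auto simp: metric_self hor_norm_def)

lemma path_lengths_horizontal: "hor_norm t (x' - x) \<in> path_lengths g (x, t) (x', t)"
  by (rule has_length_linepath)
     (auto simp: metric_self hor_norm_nonneg linepath_def algebra_simps)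

lemma path_lengths_vertical_horizontal:
  "\<bar>t' - t\<bar> + hor_norm t' (x' - x) \<in> path_lengths g (x, t) (x', t')"
  using path_lengths_trans path_lengths_vertical path_lengths_horizontal by blast

lemma path_lengths_nonempty: "path_lengths g p q \<noteq> {}"
  by (metis empty_iff path_lengths_vertical_horizontal surj_pair)

lemma riem_dist_le: "L \<in> path_lengths g p q \<Longrightarrow> riem_dist g p q \<le> L"
  by (simp add: riem_dist_eq_Inf_path_lengths cInf_lower path_lengths_bdd_below)

lemma riem_dist_less_iff: "riem_dist g p q < r \<longleftrightarrow> (\<exists>L\<in>path_lengths g p q. L < r)"
  by (simp add: riem_dist_eq_Inf_path_lengths cInf_less_iff path_lengths_nonempty path_lengths_bdd_below)

lemma riem_dist_triangle: "riem_dist g p w \<le> riem_dist g p q + riem_dist g q w"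
proof (rule field_le_epsilon)
  fix e :: real assume "e > 0"
  then obtain L1 L2 where "L1 \<in> path_lengths g p q" "L1 < riem_dist g p q + e/2"
    "L2 \<in> path_lengths g q w" "L2 < riem_dist g q w + e/2"
    using riem_dist_less_iff[of p q "riem_dist g p q + e/2"] riem_dist_less_iff[of q w "riem_dist g q w + e/2"]
    by auto
  then show "riem_dist g p w \<le> riem_dist g p q + riem_dist g q w + e"
    using riem_dist_le[OF path_lengths_trans] by fastforce
qed

text \<open>Openness makes balls Borel sets. Around a point of the ball, the length of the path that
  is first vertical and then horizontal is a continuous upper bound for the additional
  distance.\<close>

lemma open_riem_ball: "open (riem_ball g p r)"
proof (subst open_subopen, safe)
  fix x t assume q: "(x, t) \<in> riem_ball g p r"
  define T where "T = {q'. riem_dist g p (x, t) + (\<bar>snd q' - t\<bar> + hor_norm (snd q') (fst q' - x)) < r}"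
  have "continuous_on UNIV (\<lambda>q'. N *v (fst q' - x))"
    by (rule bounded_linear.continuous_on[OF matrix_vector_mul_bounded_linear]) (intro continuous_intros)
  then have "open T"
    unfolding T_def hor_norm_def by (intro open_Collect_less continuous_intros)
  moreover have "(x, t) \<in> T"
    using q by (simp add: T_def riem_ball_def hor_norm_def)
  moreover have "T \<subseteq> riem_ball g p r"
  proof safe
    fix x' t' assume "(x', t') \<in> T"
    then show "(x', t') \<in> riem_ball g p r"
      using riem_dist_triangle[of p "(x', t')" "(x, t)"]
        riem_dist_le[OF path_lengths_vertical_horizontal[of t' t x' x]]
      by (auto simp: T_def riem_ball_def)
  qed
  ultimately show "\<exists>T. open T \<and> (x, t) \<in> T \<and> T \<subseteq> riem_ball g p r" by blast
qed

text \<open>The fundamental theorem of calculus for \<open>\<phi>\<close> along the curve, with an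
  integrand dominated by \<open>K\<close> times the speed. It serves both the height, with
  \<open>K\<close> equal to 1, and the coordinates z_i.\<close>

lemma path_functional_bound:
  fixes \<phi> :: "(real^'k) \<times> real \<Rightarrow> real"
  assumes \<gamma>: "valid_path \<gamma>" "has_length g \<gamma> L" and \<phi>: "bounded_linear \<phi>"
    and ab: "0 \<le> a" "a \<le> b" "b \<le> 1" and "K \<ge> 0"
    and bound: "\<And>s u. s \<in> {0..1} \<Longrightarrow> \<bar>\<phi> u\<bar> \<le> K * sqrt (g (\<gamma> s) u u)"
  shows "\<bar>\<phi> (\<gamma> b) - \<phi> (\<gamma> a)\<bar> \<le> K * L"
proof -
  define v where "v s = vector_derivative \<gamma> (at s)" for s
  define f where "f s = sqrt (g (\<gamma> s) (v s) (v s))" for s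
  have f: "(f has_integral L) {0..1}"
    using \<gamma> by (simp add: has_length_def f_def[abs_def] v_def)
  obtain S where S: "finite S" "\<forall>x\<in>{0..1} - S. \<gamma> differentiable at x" and cont: "continuous_on {0..1} \<gamma>"
    using \<gamma>(1) by (auto simp: valid_path_def piecewise_C1_differentiable_on_def C1_differentiable_on_eq)
  have 1: "((\<lambda>s. \<phi> (v s)) has_integral (\<phi> (\<gamma> b) - \<phi> (\<gamma> a))) {a..b}"
  proof (rule fundamental_theorem_of_calculus_interior_strong[OF S(1) ab(2)])
    show "((\<lambda>s. \<phi> (\<gamma> s)) has_vector_derivative \<phi> (v x)) (at x)" if "x \<in> {a<..<b} - S" for x
      using S(2) that ab unfolding v_def
      by (intro bounded_linear.has_vector_derivative[OF \<phi>]) (auto simp: vector_derivative_works[symmetric])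
    show "continuous_on {a..b} (\<lambda>s. \<phi> (\<gamma> s))"
      by (rule bounded_linear.continuous_on[OF \<phi>], rule continuous_on_subset[OF cont]) (use ab in auto)
  qed
  have fi: "f integrable_on {a..b}"
    using f ab by (meson atLeastatMost_subset_iff has_integral_integrable integrable_subinterval_real)
  have "norm (integral {a..b} (\<lambda>s. \<phi> (v s))) \<le> integral {a..b} (\<lambda>s. K * f s)"
  proof (rule integral_norm_bound_integral)
    show "norm (\<phi> (v s)) \<le> K * f s" if "s \<in> {a..b}" for s
      using bound[of s "v s"] that ab by (simp add: f_def)
  qed (use 1 fi in \<open>auto intro!: integrable_on_mult_right\<close>)
  also have "\<dots> = K * integral {a..b} f" by simp
  also have "\<dots> \<le> K * integral {0..1} f"
    using fi f ab \<open>K \<ge> 0\<close>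
    by (intro mult_left_mono integral_subset_le) (auto simp: f_def metric_nonneg)
  finally show ?thesis
    using 1 f by (simp add: integral_unique)
qed

lemma path_height_bound:
  assumes "valid_path \<gamma>" "has_length g \<gamma> L" "a \<in> {0..1}" "b \<in> {0..1}"
  shows "\<bar>snd (\<gamma> b) - snd (\<gamma> a)\<bar> \<le> L"
proof -
  have "\<bar>snd u\<bar> \<le> 1 * sqrt (g p u u)" for p and u :: "(real^'k) \<times> real"
    unfolding metric_self by (simp add: real_le_rsqrt)
  then have "\<bar>snd (\<gamma> b) - snd (\<gamma> a)\<bar> \<le> 1 * L" if "0 \<le> a" "a \<le> b" "b \<le> 1" for a b
    using assms that by (intro path_functional_bound bounded_linear_snd) auto
  from this[of a b] this[of b a] assms(3,4) show ?thesis
    by (cases "a \<le> b") (auto simp: abs_minus_commute)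
qed

text \<open>At height t a unit tangent vector changes z_i at rate at most exp (l_i t), and
  \<open>m\<close> bounds this exponent along the whole curve. In this way the extreme heights
  control the horizontal displacement.\<close>

lemma path_component_bound:
  assumes "valid_path \<gamma>" "has_length g \<gamma> L"
    and m: "\<And>s. s \<in> {0..1} \<Longrightarrow> l i * snd (\<gamma> s) \<le> m"
  shows "\<bar>(N *v fst (pathfinish \<gamma>)) $ i - (N *v fst (pathstart \<gamma>)) $ i\<bar> \<le> exp m * L"
  unfolding pathfinish_def pathstart_def
proof (rule path_functional_bound[OF assms(1,2)])
  have "bounded_linear (\<lambda>u. (N *v fst u) $ i)"
    by (intro bounded_linear_compose[OF bounded_linear_vec_nth]
        bounded_linear_compose[OF matrix_vector_mul_bounded_linear] bounded_linear_fst)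
  then show "bounded_linear (\<lambda>u::(real^'k) \<times> real. (N *v fst u) $ i)" .
  fix s :: real and u :: "(real^'k) \<times> real" assume s: "s \<in> {0..1}"
  let ?t = "snd (\<gamma> s)"
  have "\<bar>(N *v fst u) $ i\<bar> = exp (l i * ?t) * (exp (- l i * ?t) * \<bar>(N *v fst u) $ i\<bar>)"
    by (simp add: mult.assoc[symmetric] exp_add[symmetric])
  also have "\<dots> \<le> exp m * hor_norm ?t (fst u)"
    using m[OF s] by (intro mult_mono component_le_hor_norm) auto
  also have "\<dots> \<le> exp m * sqrt (g (\<gamma> s) u u)"
    unfolding metric_self by (intro mult_left_mono) (auto simp: real_le_rsqrt)
  finally show "\<bar>(N *v fst u) $ i\<bar> \<le> exp m * sqrt (g (\<gamma> s) u u)" .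
qed auto

end

section \<open>Volume of balls\<close>

text \<open>The block matrix with blocks 1 and \<open>M\<close> on the full tangent space:
  \<open>None\<close> stands for the height direction, as in \<open>coord_vector\<close>.\<close>

definition option_extend :: "real^'k^'k \<Rightarrow> real^('k option)^('k option)" where
  "option_extend M = (\<chi> i j. case (i, j) of
      (None, None) \<Rightarrow> 1
    | (Some a, Some b) \<Rightarrow> M $ a $ b
    | _ \<Rightarrow> 0)"

lemma sum_option: "(\<Sum>i\<in>UNIV. f i) = f None + (\<Sum>a\<in>UNIV. f (Some a))"
  for f :: "'k::finite option \<Rightarrow> 'a::comm_monoid_add"
  by (simp add: UNIV_option_conv sum.reindex)

lemma prod_option: "(\<Prod>i\<in>UNIV. f i) = f None * (\<Prod>a\<in>UNIV. f (Some a))"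
  for f :: "'k::finite option \<Rightarrow> 'a::comm_monoid_mult"
  by (simp add: UNIV_option_conv prod.reindex)

lemma option_extend_mult: "option_extend M ** option_extend M' = option_extend (M ** M')"
proof -
  have "(option_extend M ** option_extend M') $ i $ j = option_extend (M ** M') $ i $ j" for i j
    by (cases i; cases j) (simp_all add: option_extend_def matrix_matrix_mult_def sum_option)
  then show ?thesis by (simp add: vec_eq_iff)
qed

lemma option_extend_mat_1: "option_extend (mat 1) = mat 1"
  by (auto simp: vec_eq_iff option_extend_def mat_def split: option.splits)

text \<open>Uniqueness of Haar measure, by evaluating the double integral of
  \<open>1\<^sub>A(x) 1\<^sub>B(x + y)\<close> in both orders. It replaces the linear change of variables of the
  library, which is restricted to well-ordered index types.\<close>

lemma translation_invariant_emeasure: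
  fixes \<mu> :: "'a::euclidean_space measure"
  assumes "sigma_finite_measure \<mu>" and sets_\<mu> [measurable_cong]: "sets \<mu> = sets borel"
    and inv: "\<And>c. distr \<mu> borel ((+) c) = \<mu>"
    and [measurable]: "A \<in> sets borel" "B \<in> sets borel"
  shows "emeasure \<mu> A * emeasure lborel B = emeasure \<mu> B * emeasure lborel A"
proof -
  interpret \<mu>: sigma_finite_measure \<mu> by fact
  interpret pair_sigma_finite \<mu> lborel ..
  have refl: "distr lborel borel (\<lambda>y. x - y) = lborel" for x :: 'a
    using lborel_affine[of "-1" x] by (simp add: density_1)
  have "emeasure \<mu> A * emeasure lborel B = (\<integral>\<^sup>+x. indicator A x * emeasure lborel B \<partial>\<mu>)"
    by (subst nn_integral_multc) (auto simp: sets_\<mu>)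
  also have "\<dots> = (\<integral>\<^sup>+x. (\<integral>\<^sup>+y. indicator A x * indicator B (x + y) \<partial>lborel) \<partial>\<mu>)"
  proof (rule nn_integral_cong)
    fix x
    have "emeasure lborel B = (\<integral>\<^sup>+y. indicator B y \<partial>distr lborel borel ((+) x))"
      unfolding lborel_distr_plus by simp
    also have "\<dots> = (\<integral>\<^sup>+y. indicator B (x + y) \<partial>lborel)"
      by (rule nn_integral_distr) auto
    finally show "indicator A x * emeasure lborel B = (\<integral>\<^sup>+y. indicator A x * indicator B (x + y) \<partial>lborel)"
      by (simp add: nn_integral_cmult)
  qed
  also have "\<dots> = (\<integral>\<^sup>+y. (\<integral>\<^sup>+x. indicator A x * indicator B (x + y) \<partial>\<mu>) \<partial>lborel)"
    by (rule Fubini'[symmetric]) measurable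
  also have "\<dots> = (\<integral>\<^sup>+y. (\<integral>\<^sup>+x. indicator B x * indicator A (x - y) \<partial>\<mu>) \<partial>lborel)"
  proof (rule nn_integral_cong)
    fix y
    have "(\<integral>\<^sup>+x. indicator B x * indicator A (x - y) \<partial>\<mu>)
        = (\<integral>\<^sup>+x. indicator B x * indicator A (x - y) \<partial>distr \<mu> borel ((+) y))"
      by (simp add: inv)
    also have "\<dots> = (\<integral>\<^sup>+x. indicator A x * indicator B (x + y) \<partial>\<mu>)"
      by (subst nn_integral_distr) (auto simp: mult.commute add.commute)
    finally show "(\<integral>\<^sup>+x. indicator A x * indicator B (x + y) \<partial>\<mu>)
        = (\<integral>\<^sup>+x. indicator B x * indicator A (x - y) \<partial>\<mu>)" by simp
  qed
  also have "\<dots> = (\<integral>\<^sup>+x. (\<integral>\<^sup>+y. indicator B x * indicator A (x - y) \<partial>lborel) \<partial>\<mu>)"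
    by (rule Fubini') measurable
  also have "\<dots> = (\<integral>\<^sup>+x. indicator B x * emeasure lborel A \<partial>\<mu>)"
  proof (rule nn_integral_cong)
    fix x
    have "emeasure lborel A = (\<integral>\<^sup>+y. indicator A y \<partial>distr lborel borel (\<lambda>y. x - y))"
      unfolding refl by simp
    also have "\<dots> = (\<integral>\<^sup>+y. indicator A (x - y) \<partial>lborel)"
      by (rule nn_integral_distr) auto
    finally show "(\<integral>\<^sup>+y. indicator B x * indicator A (x - y) \<partial>lborel) = indicator B x * emeasure lborel A"
      by (simp add: nn_integral_cmult)
  qed
  also have "\<dots> = emeasure \<mu> B * emeasure lborel A"
    by (subst nn_integral_multc) (auto simp: sets_\<mu>)
  finally show ?thesis .
qed

section \<open>Riemannian volume of coordinate boxes\<close>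

context warped_metric begin

text \<open>Adapted coordinates diagonalise the form, so the determinant in the volume density is
  that of a diagonal matrix times the square of a constant.\<close>

lemma gram_matrix_eq:
  "gram_matrix g p = transpose (option_extend N) **
     ((\<chi> i j. if i = j then case i of None \<Rightarrow> 1 | Some a \<Rightarrow> exp (- 2 * l a * snd p) else 0) ** option_extend N)"
  (is "_ = _ ** (?T ** _)")
proof -
  have T: "(?T ** option_extend N) $ i $ j =
    (case i of None \<Rightarrow> 1 | Some a \<Rightarrow> exp (- 2 * l a * snd p)) * option_extend N $ i $ j" for i j
    by (simp add: matrix_matrix_mult_def if_distrib[of "\<lambda>x. x * _"] cong: if_cong)
  have "gram_matrix g p $ i $ j = (transpose (option_extend N) ** (?T ** option_extend N)) $ i $ j" for i j
    unfolding matrix_matrix_mult_def[of "transpose _"] vec_lambda_beta T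
    by (cases i; cases j)
       (simp_all add: gram_matrix_def coord_vector_def metric transpose_def sum_option option_extend_def
         matrix_vector_mult_basis column_def mult_ac)
  then show ?thesis by (simp add: vec_eq_iff)
qed

lemma det_option_extend_N: "det (option_extend N) \<noteq> 0"
proof -
  have "option_extend N ** option_extend P = mat 1"
    by (simp add: option_extend_mult NP option_extend_mat_1)
  then have "det (option_extend N) * det (option_extend P) = 1"
    by (metis det_I det_mul)
  then show ?thesis by auto
qed

definition "vol_const = \<bar>det (option_extend N)\<bar>"

lemma vol_const_pos: "vol_const > 0"
  by (simp add: vol_const_def det_option_extend_N)

lemma sqrt_det_gram: "sqrt (det (gram_matrix g p)) = vol_const * exp (- sum l UNIV * snd p)"
proof -
  have "det (\<chi> i j. if i = j then case i of None \<Rightarrow> 1 | Some a \<Rightarrow> exp (- 2 * l a * snd p) else 0)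
      = (\<Prod>a\<in>UNIV. exp (- 2 * l a * snd p))"
    by (subst det_diagonal) (simp_all add: prod_option)
  also have "\<dots> = exp (- sum l UNIV * snd p) ^ 2"
  proof -
    have "(\<Prod>a\<in>UNIV. exp (- 2 * l a * snd p)) = exp (\<Sum>a\<in>UNIV. - 2 * l a * snd p)"
      by (simp only: exp_sum finite)
    also have "(\<Sum>a\<in>UNIV. - 2 * l a * snd p) = 2 * (- sum l UNIV * snd p)"
      by (simp only: sum_distrib_left[symmetric] sum_distrib_right[symmetric])
    finally show ?thesis by (simp only: exp_double)
  qed
  finally have "det (gram_matrix g p) = (det (option_extend N) * exp (- sum l UNIV * snd p))\<^sup>2"
    by (simp add: gram_matrix_eq det_mul power2_eq_square mult_ac)
  then show ?thesis by (simp add: vol_const_def abs_mult)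
qed

lemma riem_volume_eq:
  "riem_volume g = density lborel (\<lambda>p. ennreal (vol_const * exp (- sum l UNIV * snd p)))"
  by (simp add: riem_volume_def sqrt_det_gram)

lemma sets_riem_volume [measurable_cong]: "sets (riem_volume g) = sets borel"
  by (simp add: riem_volume_eq)

lemma emeasure_riem_volume:
  assumes "S \<in> sets borel"
  shows "emeasure (riem_volume g) S =
    (\<integral>\<^sup>+p. ennreal (vol_const * exp (- sum l UNIV * snd p)) * indicator S p \<partial>lborel)"
proof -
  have "(\<lambda>p. ennreal (vol_const * exp (- sum l UNIV * snd p))) \<in> borel_measurable (borel :: ((real^'k) \<times> real) measure)"
    by (intro measurable_compose[OF _ measurable_ennreal] borel_measurable_continuous_onI continuous_intros)
  then show ?thesis
    unfolding riem_volume_eq using assms by (intro emeasure_density) auto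
qed

definition coord_box :: "('k \<Rightarrow> real) \<Rightarrow> (real^'k) set" where
  "coord_box b = {x. \<forall>i. \<bar>(N *v x) $ i\<bar> \<le> b i}"

lemma mem_coord_box_iff: "x \<in> coord_box b \<longleftrightarrow> N *v x \<in> cbox (\<chi> i. - b i) (\<chi> i. b i)"
proof -
  have "\<bar>a\<bar> \<le> b \<longleftrightarrow> - b \<le> a \<and> a \<le> b" for a b :: real by auto
  then show ?thesis by (simp add: coord_box_def mem_box_cart)
qed

lemma coord_box_eq_image: "coord_box b = (*v) P ` cbox (\<chi> i. - b i) (\<chi> i. b i)"
proof safe
  fix x assume "x \<in> coord_box b"
  then show "x \<in> (*v) P ` cbox (\<chi> i. - b i) (\<chi> i. b i)"
    by (metis P_N_vec imageI mem_coord_box_iff)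
qed (simp add: mem_coord_box_iff)

lemma borel_measurable_matrix_vector_mult: "(*v) (M :: real^'k^'k) \<in> borel_measurable borel"
  by (intro borel_measurable_continuous_onI linear_continuous_on) simp

lemma coord_box_borel: "coord_box b \<in> sets borel"
  unfolding coord_box_eq_image
  by (intro borel_closed compact_imp_closed compact_continuous_image linear_continuous_on) auto

text \<open>The image of Lebesgue measure under \<open>N\<close> is translation invariant, hence
  proportional to Lebesgue measure. The factor is read off from the unit cube \<open>?Q\<close> and
  is finite because the preimage of the cube is compact.\<close>

lemma emeasure_lborel_linear_vimage:
  obtains c where "c > 0" "\<And>S. S \<in> sets borel \<Longrightarrow> emeasure lborel ((*v) N -` S) = ennreal c * emeasure lborel S"
proof -
  note meas [measurable] = borel_measurable_matrix_vector_mult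
  define \<mu> where "\<mu> = distr lborel borel ((*v) N)"
  \<comment> \<open>Sigma-finiteness passes to \<open>\<mu>\<close> from its image under the inverse
    map \<open>P\<close>, which is Lebesgue measure again.\<close>
  have "distr \<mu> borel ((*v) P) = distr lborel borel (\<lambda>x. x)"
    unfolding \<mu>_def by (subst distr_distr) (auto simp: comp_def)
  then have "sigma_finite_measure (distr \<mu> borel ((*v) P))"
    by (simp add: distr_id2 lborel.sigma_finite_measure_axioms)
  then have sf: "sigma_finite_measure \<mu>"
    by (rule sigma_finite_measure_distr) (simp add: \<mu>_def)
  have inv: "distr \<mu> borel ((+) a) = \<mu>" for a
  proof -
    have "distr \<mu> borel ((+) a) = distr lborel borel (\<lambda>x. N *v ((P *v a) + x))"
      unfolding \<mu>_def by (subst distr_distr) (auto simp: comp_def matrix_vector_right_distrib)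
    also have "\<dots> = distr (distr lborel borel ((+) (P *v a))) borel ((*v) N)"
      by (subst distr_distr) (auto simp: comp_def)
    finally show ?thesis by (simp add: lborel_distr_plus \<mu>_def)
  qed
  let ?Q = "cbox 0 One :: (real^'k) set"
  have Q: "emeasure lborel ?Q = 1"
    by (subst emeasure_lborel_cbox) auto
  have em: "emeasure lborel ((*v) N -` S) = emeasure lborel ((*v) N -` ?Q) * emeasure lborel S"
    if "S \<in> sets borel" for S
    using translation_invariant_emeasure[OF sf _ inv that, of ?Q] that
    by (simp add: \<mu>_def emeasure_distr Q mult.commute)
  have "(*v) N -` ?Q = (*v) P ` ?Q"
    by (auto simp: image_iff) (metis P_N_vec)
  then have "compact ((*v) N -` ?Q)"
    by (auto intro!: compact_continuous_image linear_continuous_on)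
  then have fin: "emeasure lborel ((*v) N -` ?Q) < \<infinity>"
    by (rule emeasure_compact_finite)
  \<comment> \<open>A zero factor would make the whole space a null set.\<close>
  have "emeasure lborel ((*v) N -` ?Q) \<noteq> 0"
    using em[of UNIV] by (auto simp: emeasure_lborel_UNIV)
  then have pos: "0 < enn2real (emeasure lborel ((*v) N -` ?Q))"
    using fin by (simp add: enn2real_positive_iff zero_less_iff_neq_zero)
  have Q_real: "ennreal (enn2real (emeasure lborel ((*v) N -` ?Q))) = emeasure lborel ((*v) N -` ?Q)"
    using fin by simp
  show thesis
    by (rule that[OF pos], unfold Q_real, rule em)
qed

text \<open>This is the absolute value of the determinant of \<open>P\<close>, introduced by choice
  because only its positivity and the scaling property matter.\<close>

definition "box_const =
  (SOME c. c > 0 \<and> (\<forall>S\<in>sets borel. emeasure lborel ((*v) N -` S) = ennreal c * emeasure lborel S))"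

lemma box_const: "box_const > 0"
  "S \<in> sets borel \<Longrightarrow> emeasure lborel ((*v) N -` S) = ennreal box_const * emeasure lborel S"
proof -
  have "\<exists>c>0. \<forall>S\<in>sets borel. emeasure lborel ((*v) N -` S) = ennreal c * emeasure lborel S"
    by (rule emeasure_lborel_linear_vimage) blast
  from someI_ex[OF this] show "box_const > 0"
    "S \<in> sets borel \<Longrightarrow> emeasure lborel ((*v) N -` S) = ennreal box_const * emeasure lborel S"
    unfolding box_const_def by blast+
qed

lemma emeasure_coord_box:
  assumes "\<And>i. b i \<ge> 0"
  shows "emeasure lborel (coord_box b) = ennreal (box_const * (\<Prod>i\<in>UNIV. 2 * b i))"
proof -
  let ?C = "cbox (\<chi> i. - b i) (\<chi> i. b i)"
  have ne: "?C \<noteq> {}"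
    using assms by (auto simp: interval_ne_empty_cart intro: order_trans[of _ 0])
  have "coord_box b = (*v) N -` ?C"
    by (auto simp: mem_coord_box_iff)
  then have "emeasure lborel (coord_box b) = ennreal box_const * emeasure lborel ?C"
    by (simp add: box_const(2))
  also have "emeasure lborel ?C = ennreal (\<Prod>i\<in>UNIV. 2 * b i)"
    using content_cbox_cart[OF ne] emeasure_eq_measure2[of ?C lborel]
    by (simp add: emeasure_lborel_cbox_finite fmeasurable_cbox)
  finally show ?thesis
    using box_const(1) assms by (simp add: ennreal_mult prod_nonneg)
qed

lemma emeasure_coord_box_times:
  assumes "\<And>i. b i \<ge> 0" "a \<le> c"
  shows "emeasure lborel (coord_box b \<times> {a..c}) = ennreal (box_const * (\<Prod>i\<in>UNIV. 2 * b i) * (c - a))"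
proof -
  have "emeasure lborel (coord_box b \<times> {a..c}) = emeasure (lborel \<Otimes>\<^sub>M lborel) (coord_box b \<times> {a..c})"
    by (simp add: lborel_prod)
  also have "\<dots> = emeasure lborel (coord_box b) * emeasure lborel {a..c}"
    using coord_box_borel by (intro lborel.emeasure_pair_measure_Times) auto
  finally show ?thesis
    using assms box_const(1) by (simp add: emeasure_coord_box ennreal_mult prod_nonneg)
qed

lemma box_times_borel: "coord_box b \<times> {a..c::real} \<in> sets borel"
  using coord_box_borel by (intro borel_Times) auto

lemma emeasure_box_le:
  assumes "\<And>i. b i \<ge> 0" "a \<le> c" "\<And>t. t \<in> {a..c} \<Longrightarrow> exp (- sum l UNIV * t) \<le> E"
  shows "emeasure (riem_volume g) (coord_box b \<times> {a..c})
    \<le> ennreal (vol_const * E * (box_const * (\<Prod>i\<in>UNIV. 2 * b i) * (c - a)))"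
proof -
  have E: "E \<ge> 0" using assms(2) assms(3)[of a] exp_ge_zero order_trans by (metis atLeastAtMost_iff order_refl)
  have "emeasure (riem_volume g) (coord_box b \<times> {a..c})
    \<le> (\<integral>\<^sup>+p. ennreal (vol_const * E) * indicator (coord_box b \<times> {a..c}) p \<partial>lborel)"
    unfolding emeasure_riem_volume[OF box_times_borel]
    using assms(3) vol_const_pos
    by (intro nn_integral_mono) (auto split: split_indicator intro!: ennreal_leI mult_left_mono)
  also have "\<dots> = ennreal (vol_const * E) * emeasure lborel (coord_box b \<times> {a..c})"
    using box_times_borel by (intro nn_integral_cmult_indicator) simp
  finally show ?thesis
    using assms(1,2) E vol_const_pos box_const(1)
    by (simp add: emeasure_coord_box_times ennreal_mult[symmetric] prod_nonneg)
qed

lemma emeasure_box_ge: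
  assumes "\<And>i. b i \<ge> 0" "a \<le> c" "E \<ge> 0" "\<And>t. t \<in> {a..c} \<Longrightarrow> exp (- sum l UNIV * t) \<ge> E"
  shows "emeasure (riem_volume g) (coord_box b \<times> {a..c})
    \<ge> ennreal (vol_const * E * (box_const * (\<Prod>i\<in>UNIV. 2 * b i) * (c - a)))"
proof -
  have "ennreal (vol_const * E * (box_const * (\<Prod>i\<in>UNIV. 2 * b i) * (c - a)))
    = ennreal (vol_const * E) * emeasure lborel (coord_box b \<times> {a..c})"
    using assms(1-3) vol_const_pos box_const(1)
    by (simp add: emeasure_coord_box_times ennreal_mult[symmetric] prod_nonneg)
  also have "\<dots> = (\<integral>\<^sup>+p. ennreal (vol_const * E) * indicator (coord_box b \<times> {a..c}) p \<partial>lborel)"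
    using box_times_borel by (intro nn_integral_cmult_indicator[symmetric]) simp
  also have "\<dots> \<le> emeasure (riem_volume g) (coord_box b \<times> {a..c})"
    unfolding emeasure_riem_volume[OF box_times_borel]
    using assms(4) vol_const_pos
    by (intro nn_integral_mono) (auto split: split_indicator intro!: ennreal_leI mult_left_mono)
  finally show ?thesis .
qed

section \<open>Volume of balls about the origin\<close>

definition "pos_sum = (\<Sum>i\<in>UNIV. max (l i) 0)"
definition "neg_sum = (\<Sum>i\<in>UNIV. max (- l i) 0)"
definition "entropy = max pos_sum neg_sum"

lemma sum_l: "sum l UNIV = pos_sum - neg_sum"
  unfolding pos_sum_def neg_sum_def sum_subtractf[symmetric]
  by (rule sum.cong) auto

text \<open>A curve whose height has maximum \<open>M\<close> and minimum \<open>-m\<close> has length at least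
  \<open>M + m\<close>, and the extreme heights bound the horizontal displacement. The index \<open>j\<close> is the
  integer part of \<open>M\<close>.\<close>

lemma riem_ball_subset_boxes:
  assumes "r > 0"
  shows "riem_ball g (0, 0) r \<subseteq> (\<Union>j\<le>nat \<lfloor>r\<rfloor>.
    coord_box (\<lambda>i. r * exp (max (l i) 0 * (real j + 1) + max (- l i) 0 * (r - real j)))
      \<times> {- (r - real j)..real j + 1})"
proof safe
  fix x t assume "(x, t) \<in> riem_ball g (0, 0) r"
  then obtain L \<gamma> where \<gamma>: "valid_path \<gamma>" "pathstart \<gamma> = (0, 0)" "pathfinish \<gamma> = (x, t)" "has_length g \<gamma> L" "L < r"
    by (auto simp: riem_ball_def riem_dist_less_iff path_lengths_def)
  have "continuous_on {0..1} (\<lambda>s. snd (\<gamma> s))"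
    using \<gamma>(1) by (intro continuous_intros) (simp add: valid_path_imp_path path_def[symmetric])
  then obtain s1 s2 where s1: "s1 \<in> {0..1}" "\<forall>s\<in>{0..1}. snd (\<gamma> s) \<le> snd (\<gamma> s1)"
    and s2: "s2 \<in> {0..1}" "\<forall>s\<in>{0..1}. snd (\<gamma> s2) \<le> snd (\<gamma> s)"
    using continuous_attains_sup[of "{0..1}" "\<lambda>s. snd (\<gamma> s)"] continuous_attains_inf[of "{0..1}" "\<lambda>s. snd (\<gamma> s)"]
    by auto
  define M m where "M = snd (\<gamma> s1)" and "m = snd (\<gamma> s2)"
  have Mm: "M - m \<le> L"
    using path_height_bound[OF \<gamma>(1,4) s2(1) s1(1)] by (simp add: M_def m_def)
  have "snd (\<gamma> 0) = 0" using \<gamma>(2) by (simp add: pathstart_def)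
  then have M0: "M \<ge> 0" and m0: "m \<le> 0"
    using s1(2)[rule_format, of 0] s2(2)[rule_format, of 0] by (simp_all add: M_def m_def)
  define j where "j = nat \<lfloor>M\<rfloor>"
  have j: "real j \<le> M" "M < real j + 1"
    using M0 by (auto simp: j_def)
  have range: "- (r - real j) \<le> snd (\<gamma> s)" "snd (\<gamma> s) \<le> real j + 1" if "s \<in> {0..1}" for s
    using s1(2)[rule_format, OF that] s2(2)[rule_format, OF that] Mm j \<gamma>(5)
    unfolding M_def[symmetric] m_def[symmetric] by linarith+
  have "x \<in> coord_box (\<lambda>i. r * exp (max (l i) 0 * (real j + 1) + max (- l i) 0 * (r - real j)))"
    unfolding coord_box_def
  proof safe
    fix i
    let ?e = "max (l i) 0 * (real j + 1) + max (- l i) 0 * (r - real j)"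
    have "l i * snd (\<gamma> s) \<le> ?e" if "s \<in> {0..1}" for s
    proof (cases "l i \<ge> 0")
      case True
      then show ?thesis using range[OF that] by (simp add: mult_left_mono)
    next
      case False
      then have "- l i * - snd (\<gamma> s) \<le> - l i * (r - real j)"
        using range[OF that] by (intro mult_left_mono) auto
      then show ?thesis using False by simp
    qed
    from path_component_bound[OF \<gamma>(1,4) this] have "\<bar>(N *v x) $ i\<bar> \<le> exp ?e * L"
      by (simp add: \<gamma>)
    also have "\<dots> \<le> r * exp ?e"
      using \<gamma>(5) by simp
    finally show "\<bar>(N *v x) $ i\<bar> \<le> r * exp ?e" .
  qed
  moreover have "t \<in> {- (r - real j)..real j + 1}"
    using range[of 1] \<gamma>(3) by (simp add: pathfinish_def)
  moreover have "j \<le> nat \<lfloor>r\<rfloor>"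
    unfolding j_def using Mm m0 \<gamma>(5) by (intro nat_mono floor_mono) auto
  ultimately show "(x, t) \<in> (\<Union>j\<le>nat \<lfloor>r\<rfloor>.
    coord_box (\<lambda>i. r * exp (max (l i) 0 * (real j + 1) + max (- l i) 0 * (r - real j)))
      \<times> {- (r - real j)..real j + 1})"
    by blast
qed

text \<open>Every box of the covering has a height interval of length r + 1, and there are at most r
  + 1 boxes, whence the square. Side lengths and density together give the remaining
  factors.\<close>

lemma emeasure_riem_ball_le:
  assumes "r > 0"
  shows "emeasure (riem_volume g) (riem_ball g (0, 0) r)
    \<le> ennreal (vol_const * box_const * (2 * r) ^ CARD('k) * (r + 1)\<^sup>2 * exp (entropy * (r + 1)))"
proof -
  let ?b = "\<lambda>j i. r * exp (max (l i) 0 * (real j + 1) + max (- l i) 0 * (r - real j))"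
  let ?S = "\<lambda>j. coord_box (?b j) \<times> {- (r - real j)..real j + 1}"
  let ?V = "vol_const * box_const * (2 * r) ^ CARD('k) * (r + 1) * exp (entropy * (r + 1))"
  have n: "real (nat \<lfloor>r\<rfloor>) \<le> r" using assms by simp
  have one: "emeasure (riem_volume g) (?S j) \<le> ennreal ?V" if "j \<le> nat \<lfloor>r\<rfloor>" for j
  proof -
    let ?e = "pos_sum * (real j + 1) + neg_sum * (r - real j)"
    have jr: "real j \<le> r" using that n by linarith
    have prod: "(\<Prod>i\<in>UNIV. 2 * ?b j i) = (2 * r) ^ CARD('k) * exp ?e"
    proof -
      have "?e = (\<Sum>i\<in>UNIV. max (l i) 0 * (real j + 1) + max (- l i) 0 * (r - real j))"
        by (simp only: pos_sum_def neg_sum_def sum_distrib_right sum.distrib)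
      then show ?thesis
        by (simp only: exp_sum finite prod.distrib prod_constant power_mult_distrib mult.assoc)
    qed
    have "emeasure (riem_volume g) (?S j) \<le> ennreal (vol_const * exp (entropy * (r + 1) - ?e)
       * (box_const * (\<Prod>i\<in>UNIV. 2 * ?b j i) * (real j + 1 - - (r - real j))))"
    proof (rule emeasure_box_le)
      fix t assume t: "t \<in> {- (r - real j)..real j + 1}"
      \<comment> \<open>The exponents of density and side lengths combine \<open>pos_sum\<close> and
        \<open>neg_sum\<close> with nonnegative weights. The weights are the distances from
        \<open>t\<close> to the ends of the height interval, and they add up to r + 1.\<close>
      have "- sum l UNIV * t + ?e = pos_sum * (real j + 1 - t) + neg_sum * (r - real j + t)"
        by (simp add: sum_l algebra_simps)
      also have "\<dots> \<le> entropy * (real j + 1 - t) + entropy * (r - real j + t)"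
        using t by (intro add_mono mult_right_mono) (auto simp: entropy_def)
      also have "\<dots> = entropy * (r + 1)" by (simp add: algebra_simps)
      finally show "exp (- sum l UNIV * t) \<le> exp (entropy * (r + 1) - ?e)" by simp
    qed (use assms jr in auto)
    also have "vol_const * exp (entropy * (r + 1) - ?e)
       * (box_const * (\<Prod>i\<in>UNIV. 2 * ?b j i) * (real j + 1 - - (r - real j))) = ?V"
      unfolding prod exp_diff by (simp add: field_simps)
    finally show ?thesis .
  qed
  have "emeasure (riem_volume g) (riem_ball g (0, 0) r) \<le> emeasure (riem_volume g) (\<Union>j\<le>nat \<lfloor>r\<rfloor>. ?S j)"
    using box_times_borel
    by (intro emeasure_mono riem_ball_subset_boxes assms) (auto simp: sets_riem_volume)
  also have "\<dots> \<le> (\<Sum>j\<le>nat \<lfloor>r\<rfloor>. emeasure (riem_volume g) (?S j))"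
    using box_times_borel by (intro emeasure_subadditive_finite) (auto simp: sets_riem_volume)
  also have "\<dots> \<le> (\<Sum>j\<le>nat \<lfloor>r\<rfloor>. ennreal ?V)"
    by (intro sum_mono one) auto
  also have "\<dots> = ennreal (\<Sum>j\<le>nat \<lfloor>r\<rfloor>. ?V)"
    using vol_const_pos box_const(1) assms by (intro sum_ennreal) auto
  also have "\<dots> \<le> ennreal ((r + 1) * ?V)"
    using vol_const_pos box_const(1) assms n by (intro ennreal_leI) (simp add: mult_right_mono)
  finally show ?thesis by (simp add: power2_eq_square mult_ac)
qed

text \<open>Coordinates with \<open>l\<^sub>i t \<le> 0\<close> are adjusted at height \<open>0\<close>, the others at height
  \<open>t\<close>, where they are contracted.\<close>

lemma riem_dist_origin_le:
  "riem_dist g (0, 0) (x, t) \<le> \<bar>t\<bar> + (\<Sum>i\<in>UNIV. min 1 (exp (- l i * t)) * \<bar>(N *v x) $ i\<bar>)"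
proof -
  define x1 where "x1 = P *v (\<chi> i. if l i * t \<le> 0 then (N *v x) $ i else 0)"
  have "hor_norm 0 (x1 - 0) + (\<bar>t - 0\<bar> + hor_norm t (x - x1)) \<in> path_lengths g (0, 0) (x, t)"
    by (rule path_lengths_trans[OF path_lengths_horizontal path_lengths_vertical_horizontal])
  then have "riem_dist g (0, 0) (x, t) \<le> hor_norm 0 x1 + (\<bar>t\<bar> + hor_norm t (x - x1))"
    using riem_dist_le by fastforce
  also have "\<dots> \<le> (\<Sum>i\<in>UNIV. exp (- l i * 0) * \<bar>(N *v x1) $ i\<bar>)
      + (\<bar>t\<bar> + (\<Sum>i\<in>UNIV. exp (- l i * t) * \<bar>(N *v (x - x1)) $ i\<bar>))"
    by (intro add_mono hor_norm_le_sum order_refl)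
  also have "\<dots> = \<bar>t\<bar> + (\<Sum>i\<in>UNIV. exp (- l i * 0) * \<bar>(N *v x1) $ i\<bar> + exp (- l i * t) * \<bar>(N *v (x - x1)) $ i\<bar>)"
    by (simp add: sum.distrib)
  also have "\<dots> = \<bar>t\<bar> + (\<Sum>i\<in>UNIV. min 1 (exp (- l i * t)) * \<bar>(N *v x) $ i\<bar>)"
  proof -
    have "exp (- l i * 0) * \<bar>(N *v x1) $ i\<bar> + exp (- l i * t) * \<bar>(N *v (x - x1)) $ i\<bar>
      = min 1 (exp (- l i * t)) * \<bar>(N *v x) $ i\<bar>" for i
      by (cases "l i * t \<le> 0") (simp_all add: x1_def matrix_vector_mult_diff_distrib min_absorb1 min_absorb2)
    then show ?thesis by simp
  qed
  finally show ?thesis .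
qed

text \<open>The half-sides \<open>?b\<close> of the box are fitted to
  \<open>riem_dist_origin_le\<close>: over the heights from \<open>\<tau>\<close> to
  \<open>\<tau> + 1\<close> coordinate i costs at most exp |l_i|, so the whole box is reached within
  |\<open>\<tau>\<close>| plus a constant.\<close>

lemma emeasure_riem_ball_ge:
  assumes "r > \<bar>\<tau>\<bar> + 1 + (\<Sum>i\<in>UNIV. exp \<bar>l i\<bar>)"
  shows "emeasure (riem_volume g) (riem_ball g (0, 0) r)
    \<ge> ennreal (vol_const * exp (- \<bar>sum l UNIV\<bar>) * box_const * 2 ^ CARD('k) * (\<Prod>i\<in>UNIV. max (exp (- l i * \<tau>)) 1))"
proof -
  let ?b = "\<lambda>i. max 1 (exp (l i * \<tau>))"
  let ?S = "coord_box ?b \<times> {\<tau>..\<tau> + 1}"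
  have "?S \<subseteq> riem_ball g (0, 0) r"
  proof safe
    fix x t assume x: "x \<in> coord_box ?b" and t: "t \<in> {\<tau>..\<tau> + 1}"
    have "min 1 (exp (- l i * t)) * \<bar>(N *v x) $ i\<bar> \<le> exp \<bar>l i\<bar>" for i
    proof -
      have "min 1 (exp (- l i * t)) * \<bar>(N *v x) $ i\<bar> \<le> min 1 (exp (- l i * t)) * ?b i"
        using x by (intro mult_left_mono) (auto simp: coord_box_def)
      also have "\<dots> \<le> exp \<bar>l i\<bar>"
      proof (cases "exp (l i * \<tau>) \<le> 1")
        case True
        then show ?thesis by (simp add: min.coboundedI1)
      next
        case False
        then have "min 1 (exp (- l i * t)) * ?b i \<le> exp (- l i * t) * exp (l i * \<tau>)"
          by (intro mult_mono) auto
        also have "\<dots> = exp (l i * (\<tau> - t))"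
          by (simp add: exp_add[symmetric] algebra_simps)
        also have "l i * (\<tau> - t) \<le> \<bar>l i * (\<tau> - t)\<bar>" by simp
        also have "\<dots> \<le> \<bar>l i\<bar> * 1"
          unfolding abs_mult using t by (intro mult_left_mono) auto
        finally show ?thesis by simp
      qed
      finally show ?thesis .
    qed
    then have "(\<Sum>i\<in>UNIV. min 1 (exp (- l i * t)) * \<bar>(N *v x) $ i\<bar>) \<le> (\<Sum>i\<in>UNIV. exp \<bar>l i\<bar>)"
      by (intro sum_mono)
    then show "(x, t) \<in> riem_ball g (0, 0) r"
      using riem_dist_origin_le[of x t] assms t by (auto simp: riem_ball_def)
  qed
  then have 1: "emeasure (riem_volume g) ?S \<le> emeasure (riem_volume g) (riem_ball g (0, 0) r)"
    by (intro emeasure_mono) (auto simp: sets_riem_volume open_riem_ball)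
  \<comment> \<open>The term \<open>\<bar>sum l UNIV\<bar>\<close> absorbs the change of the density
    over a height interval of length 1.\<close>
  have 2: "ennreal (vol_const * exp (- sum l UNIV * \<tau> - \<bar>sum l UNIV\<bar>) *
      (box_const * (\<Prod>i\<in>UNIV. 2 * ?b i) * (\<tau> + 1 - \<tau>))) \<le> emeasure (riem_volume g) ?S"
  proof (rule emeasure_box_ge)
    fix t assume t: "t \<in> {\<tau>..\<tau> + 1}"
    have "sum l UNIV * (t - \<tau>) \<le> \<bar>sum l UNIV * (t - \<tau>)\<bar>" by simp
    also have "\<dots> \<le> \<bar>sum l UNIV\<bar> * 1"
      unfolding abs_mult using t by (intro mult_left_mono) auto
    finally show "exp (- sum l UNIV * \<tau> - \<bar>sum l UNIV\<bar>) \<le> exp (- sum l UNIV * t)"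
      by (simp add: algebra_simps)
  qed (auto simp: le_max_iff_disj)
  have 3: "vol_const * exp (- sum l UNIV * \<tau> - \<bar>sum l UNIV\<bar>) *
      (box_const * (\<Prod>i\<in>UNIV. 2 * ?b i) * (\<tau> + 1 - \<tau>))
    = vol_const * exp (- \<bar>sum l UNIV\<bar>) * box_const * 2 ^ CARD('k) * (\<Prod>i\<in>UNIV. max (exp (- l i * \<tau>)) 1)"
  proof -
    have "exp (- sum l UNIV * \<tau>) = exp (\<Sum>i\<in>UNIV. - l i * \<tau>)"
      by (simp add: sum_distrib_right sum_negf)
    then have "(\<Prod>i\<in>UNIV. 2 * ?b i) * exp (- sum l UNIV * \<tau>) = (\<Prod>i\<in>UNIV. 2 * ?b i * exp (- l i * \<tau>))"
      by (simp only: exp_sum finite prod.distrib)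
    also have "\<dots> = (\<Prod>i\<in>UNIV. 2 * max (exp (- l i * \<tau>)) 1)"
      by (rule prod.cong) (auto simp: max_def exp_minus field_simps)
    also have "\<dots> = 2 ^ CARD('k) * (\<Prod>i\<in>UNIV. max (exp (- l i * \<tau>)) 1)"
      by (simp only: prod.distrib prod_constant)
    finally have *: "(\<Prod>i\<in>UNIV. 2 * ?b i) * exp (- sum l UNIV * \<tau>) = \<dots>" .
    have "exp (- sum l UNIV * \<tau> - \<bar>sum l UNIV\<bar>) = exp (- sum l UNIV * \<tau>) * exp (- \<bar>sum l UNIV\<bar>)"
      by (simp add: exp_add[symmetric])
    then have "vol_const * exp (- sum l UNIV * \<tau> - \<bar>sum l UNIV\<bar>) *
        (box_const * (\<Prod>i\<in>UNIV. 2 * ?b i) * (\<tau> + 1 - \<tau>))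
      = vol_const * exp (- \<bar>sum l UNIV\<bar>) * box_const * ((\<Prod>i\<in>UNIV. 2 * ?b i) * exp (- sum l UNIV * \<tau>))"
      by simp
    then show ?thesis unfolding * by simp
  qed
  show ?thesis
    using order_trans[OF 2 1] unfolding 3 .
qed

end

section \<open>The entropy as a limit\<close>

lemma has_volume_entropy_unique:
  assumes "has_volume_entropy g a" "has_volume_entropy g b"
  shows "a = b"
  using assms unfolding has_volume_entropy_def
  by (meson tendsto_unique trivial_limit_at_top_linorder)

lemma volume_entropy_eq: "has_volume_entropy g a \<Longrightarrow> volume_entropy g = a"
  unfolding volume_entropy_def using has_volume_entropy_unique by blast

context warped_metric begin

text \<open>Going down produces \<open>pos_sum\<close>, going up \<open>neg_sum\<close>: the product
  in the lower bound is exp (pos_sum R) at height -R and exp (neg_sum R) at height R. The larger one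
  is used.\<close>

lemma emeasure_riem_ball_exp_ge:
  assumes "R \<ge> 0" "r > R + 1 + (\<Sum>i\<in>UNIV. exp \<bar>l i\<bar>)"
  shows "emeasure (riem_volume g) (riem_ball g (0, 0) r)
    \<ge> ennreal (vol_const * exp (- \<bar>sum l UNIV\<bar>) * box_const * 2 ^ CARD('k) * exp (entropy * R))"
proof -
  have *: "max (exp (c * R)) 1 = exp (max c 0 * R)" for c
    using assms(1) by (cases "c \<ge> 0") (simp_all add: max_absorb1 max_absorb2 mult_nonpos_nonneg)
  have neg: "(\<Prod>i\<in>UNIV. max (exp (- l i * R)) 1) = exp (neg_sum * R)"
    by (simp only: * neg_sum_def sum_distrib_right exp_sum finite)
  have "- l i * - R = l i * R" for i by simp
  then have pos: "(\<Prod>i\<in>UNIV. max (exp (- l i * - R)) 1) = exp (pos_sum * R)"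
    by (simp only: * pos_sum_def sum_distrib_right exp_sum finite)
  show ?thesis
  proof (cases "pos_sum \<ge> neg_sum")
    case True
    then show ?thesis
      using emeasure_riem_ball_ge[of "- R" r] assms unfolding pos by (simp add: entropy_def)
  next
    case False
    then show ?thesis
      using emeasure_riem_ball_ge[of R r] assms unfolding neg by (simp add: entropy_def)
  qed
qed

text \<open>Balls about \<open>x\<close> lie between balls about the origin whose radii differ from
  r by constants, so both bounds carry over. Logarithms turn the polynomial factors into terms that
  vanish after division by r.\<close>

theorem has_volume_entropy: "has_volume_entropy g entropy"
  unfolding has_volume_entropy_def
proof
  fix x
  define d1 d2 where "d1 = riem_dist g x (0, 0)" and "d2 = riem_dist g (0, 0) x"
  \<comment> \<open>With R = r - c, the radius r - d1 exceeds the threshold of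
    \<open>emeasure_riem_ball_exp_ge\<close> by exactly 1, which secures the strict
    inequality.\<close>
  define c where "c = d1 + 2 + (\<Sum>i\<in>UNIV. exp \<bar>l i\<bar>)"
  define K1 K2 where "K1 = vol_const * exp (- \<bar>sum l UNIV\<bar>) * box_const * 2 ^ CARD('k)"
    and "K2 = vol_const * box_const * 2 ^ CARD('k)"
  define V where "V r = measure (riem_volume g) (riem_ball g x r)" for r
  have K: "K1 > 0" "K2 > 0"
    using vol_const_pos box_const(1) by (auto simp: K1_def K2_def)
  let ?lo = "\<lambda>r. (ln K1 + entropy * (r - c)) / r"
  let ?hi = "\<lambda>r. (ln K2 + (real CARD('k) * ln (r + d2) + (2 * ln (r + d2 + 1) + entropy * (r + d2 + 1)))) / r"
  have ev: "?lo r \<le> ln (V r) / r \<and> ln (V r) / r \<le> ?hi r" if r: "r > 0" "r > c" "r > - d2" for r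
  proof -
    have "q \<in> riem_ball g x r" if "q \<in> riem_ball g (0, 0) (r - d1)" for q
      using that riem_dist_triangle[of x q "(0, 0)"] by (simp add: riem_ball_def d1_def)
    then have "emeasure (riem_volume g) (riem_ball g (0, 0) (r - d1)) \<le> emeasure (riem_volume g) (riem_ball g x r)"
      by (intro emeasure_mono) (auto simp: sets_riem_volume open_riem_ball)
    then have lo: "ennreal (K1 * exp (entropy * (r - c))) \<le> emeasure (riem_volume g) (riem_ball g x r)"
      unfolding K1_def
      by (intro order_trans[OF emeasure_riem_ball_exp_ge]) (use r in \<open>auto simp: c_def\<close>)
    have "q \<in> riem_ball g (0, 0) (r + d2)" if "q \<in> riem_ball g x r" for q
      using that riem_dist_triangle[of "(0, 0)" q x] by (simp add: riem_ball_def d2_def)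
    then have "emeasure (riem_volume g) (riem_ball g x r) \<le> emeasure (riem_volume g) (riem_ball g (0, 0) (r + d2))"
      by (intro emeasure_mono) (auto simp: sets_riem_volume open_riem_ball)
    also have "\<dots> \<le> ennreal (vol_const * box_const * (2 * (r + d2)) ^ CARD('k) * (r + d2 + 1)\<^sup>2
        * exp (entropy * (r + d2 + 1)))"
      by (rule emeasure_riem_ball_le) (use r in simp)
    also have "vol_const * box_const * (2 * (r + d2)) ^ CARD('k) * (r + d2 + 1)\<^sup>2 * exp (entropy * (r + d2 + 1))
      = K2 * ((r + d2) ^ CARD('k) * ((r + d2 + 1)\<^sup>2 * exp (entropy * (r + d2 + 1))))"
      by (simp only: K2_def power_mult_distrib mult_ac)
    finally have hi: "emeasure (riem_volume g) (riem_ball g x r)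
      \<le> ennreal (K2 * ((r + d2) ^ CARD('k) * ((r + d2 + 1)\<^sup>2 * exp (entropy * (r + d2 + 1)))))" .
    \<comment> \<open>Finiteness comes from the upper bound; \<open>measure\<close> would be 0 on a
      set of infinite volume.\<close>
    then have Vr: "emeasure (riem_volume g) (riem_ball g x r) = ennreal (V r)"
      unfolding V_def by (intro emeasure_eq_ennreal_measure) (auto simp: top_unique)
    have "V r \<ge> 0"
      by (simp add: V_def)
    with lo have V1: "K1 * exp (entropy * (r - c)) \<le> V r"
      unfolding Vr by simp
    have "K2 * ((r + d2) ^ CARD('k) * ((r + d2 + 1)\<^sup>2 * exp (entropy * (r + d2 + 1)))) \<ge> 0"
      using K r by simp
    with hi have V2: "V r \<le> K2 * ((r + d2) ^ CARD('k) * ((r + d2 + 1)\<^sup>2 * exp (entropy * (r + d2 + 1))))"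
      unfolding Vr by simp
    have V0: "V r > 0"
      using K V1 by (smt (verit) exp_gt_zero mult_pos_pos)
    have "ln K1 + entropy * (r - c) = ln (K1 * exp (entropy * (r - c)))"
      using K by (simp add: ln_mult)
    also have "\<dots> \<le> ln (V r)" using V1 V0 K by simp
    finally have 1: "ln K1 + entropy * (r - c) \<le> ln (V r)" .
    have "ln (V r) \<le> ln (K2 * ((r + d2) ^ CARD('k) * ((r + d2 + 1)\<^sup>2 * exp (entropy * (r + d2 + 1)))))"
      using V2 V0 by simp
    also have "\<dots> = ln K2 + (real CARD('k) * ln (r + d2) + (2 * ln (r + d2 + 1) + entropy * (r + d2 + 1)))"
      using K r by (simp add: ln_mult ln_realpow)
    finally show ?thesis
      using 1 r by (auto intro: divide_right_mono)
  qed
  have ev: "eventually (\<lambda>r. ?lo r \<le> ln (V r) / r \<and> ln (V r) / r \<le> ?hi r) at_top"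
    using eventually_gt_at_top[of 0] eventually_gt_at_top[of c] eventually_gt_at_top[of "- d2"]
    by eventually_elim (rule ev)
  show "((\<lambda>r. ln (measure (riem_volume g) (riem_ball g x r)) / r) \<longlongrightarrow> entropy) at_top"
    unfolding V_def[symmetric]
  proof (rule tendsto_sandwich)
    have inv: "((\<lambda>r. a / r) \<longlongrightarrow> 0) at_top" and ln: "((\<lambda>r. ln (r + a) / r) \<longlongrightarrow> 0) at_top" for a :: real
      by real_asymp+
    have "((\<lambda>r. entropy + (ln K1 - entropy * c) / r) \<longlongrightarrow> entropy + 0) at_top"
      by (intro tendsto_intros inv)
    then have "(?lo \<longlongrightarrow> entropy + 0) at_top"
      by (rule Lim_transform_eventually)
         (use eventually_gt_at_top[of 0] in eventually_elim, simp add: field_simps)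
    then show "(?lo \<longlongrightarrow> entropy) at_top" by simp
    have "((\<lambda>r. entropy + (ln K2 + entropy * (d2 + 1)) / r + real CARD('k) * (ln (r + d2) / r)
        + 2 * (ln (r + (d2 + 1)) / r)) \<longlongrightarrow> entropy + 0 + real CARD('k) * 0 + 2 * 0) at_top"
      by (intro tendsto_intros inv ln)
    then have "(?hi \<longlongrightarrow> entropy + 0 + real CARD('k) * 0 + 2 * 0) at_top"
      by (rule Lim_transform_eventually)
         (use eventually_gt_at_top[of 0] in eventually_elim, simp add: field_simps)
    then show "(?hi \<longlongrightarrow> entropy) at_top" by simp
  qed (use ev in \<open>auto elim: eventually_mono\<close>)
qed

end

section \<open>Diagonalising the metric\<close>

text \<open>Pairing the coordinates \<open>i\<close> and \<open>\<sigma> i\<close> into one complex number turns every block of \<open>D\<close>,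
  of size one or two, into multiplication by a complex number.\<close>

lemma real_jordan_complex_coordinates:
  assumes "real_jordan_block_diagonal D"
  obtains \<sigma> z where "\<And>i. \<sigma> (\<sigma> i) = i" "\<And>i. Re (z i) = D $ i $ i" "\<And>i. D $ \<sigma> i $ \<sigma> i = D $ i $ i"
    "\<And>a i. Complex ((D *v a) $ i) ((D *v a) $ \<sigma> i) = z i * Complex (a $ i) (a $ \<sigma> i)"
proof -
  obtain \<sigma> where \<sigma>: "\<And>i. \<sigma> (\<sigma> i) = i" and off: "\<And>i j. j \<noteq> i \<Longrightarrow> j \<noteq> \<sigma> i \<Longrightarrow> D $ i $ j = 0"
    and diag: "\<And>i. \<sigma> i \<noteq> i \<Longrightarrow> D $ \<sigma> i $ \<sigma> i = D $ i $ i"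
    and anti: "\<And>i. \<sigma> i \<noteq> i \<Longrightarrow> D $ \<sigma> i $ i = - D $ i $ \<sigma> i"
    using assms unfolding real_jordan_block_diagonal_def by metis
  \<comment> \<open>The imaginary part of the multiplier. The value 0 at fixed points of
    \<open>\<sigma>\<close> lets one formula for \<open>D *v a\<close> cover both block
    sizes.\<close>
  define \<beta> where "\<beta> i = (if \<sigma> i = i then 0 else D $ \<sigma> i $ i)" for i
  have \<beta>: "\<beta> (\<sigma> i) = - \<beta> i" for i
    using anti[of i] by (auto simp: \<beta>_def \<sigma>)
  have diag': "D $ \<sigma> i $ \<sigma> i = D $ i $ i" for i
    using diag[of i] by metis
  have D: "(D *v a) $ i = D $ i $ i * a $ i - \<beta> i * a $ \<sigma> i" for a i
  proof (cases "\<sigma> i = i")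
    case True
    have "(D *v a) $ i = (\<Sum>j\<in>{i}. D $ i $ j * a $ j)"
      unfolding matrix_vector_mult_def vec_lambda_beta
      by (rule sum.mono_neutral_right) (auto simp: off True)
    then show ?thesis by (simp add: \<beta>_def True)
  next
    case False
    have "(D *v a) $ i = (\<Sum>j\<in>{i, \<sigma> i}. D $ i $ j * a $ j)"
      unfolding matrix_vector_mult_def vec_lambda_beta
      by (rule sum.mono_neutral_right) (auto simp: off)
    then show ?thesis using False anti[of i] by (auto simp: \<beta>_def)
  qed
  show thesis
    by (rule that[of \<sigma> "\<lambda>i. Complex (D $ i $ i) (\<beta> i)"])
       (auto simp: \<sigma> diag' D \<beta> complex_eq_iff algebra_simps)
qed

lemma matrix_inv_mult:
  assumes "invertible P"
  shows "P ** matrix_inv P = mat 1" "matrix_inv P ** P = mat 1"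
  using someI_ex[OF assms[unfolded invertible_def]] by (simp_all add: matrix_inv_def)

lemma summable_matrix:
  fixes f :: "nat \<Rightarrow> real^'n^'m"
  assumes "\<And>a b. summable (\<lambda>n. f n $ a $ b)"
  shows "summable f"
proof -
  have "f sums (\<chi> a b. \<Sum>n. f n $ a $ b)"
    unfolding sums_def
  proof (intro vec_tendstoI)
    fix a b
    show "((\<lambda>n. (\<Sum>i<n. f i) $ a $ b) \<longlongrightarrow> (\<chi> a b. \<Sum>n. f n $ a $ b) $ a $ b) sequentially"
      using summable_LIMSEQ[OF assms[of a b]] by (simp add: sum_component)
  qed
  then show ?thesis by (rule sums_summable)
qed

text \<open>In the complex coordinate \<open>W x i\<close> the matrix \<open>M\<close> multiplies by
  \<open>z i\<close>, its powers by powers of \<open>z i\<close>, and the exponential series by exp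
  (z i). Applying a linear map termwise requires convergence of the matrix series, which is
  established first.\<close>

lemma matrix_exp_complex_coordinates:
  fixes M N P :: "real^'k^'k"
  assumes PN: "P ** N = mat 1"
    and eig: "\<And>x i. Complex ((N *v (M *v x)) $ i) ((N *v (M *v x)) $ \<sigma> i)
        = z i * Complex ((N *v x) $ i) ((N *v x) $ \<sigma> i)"
  shows "Complex ((N *v (matrix_exp M *v x)) $ i) ((N *v (matrix_exp M *v x)) $ \<sigma> i)
        = exp (z i) * Complex ((N *v x) $ i) ((N *v x) $ \<sigma> i)"
proof -
  define W where "W x i = Complex ((N *v x) $ i) ((N *v x) $ \<sigma> i)" for x i
  define Mn where "Mn n = (((**) M) ^^ n) (mat 1)" for n
  have W_Mn: "W (Mn n *v x) i = z i ^ n * W x i" for n x i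
  proof (induction n)
    case (Suc n)
    have "Mn (Suc n) *v x = M *v (Mn n *v x)"
      by (simp add: Mn_def matrix_vector_mul_assoc)
    then show ?case using Suc by (simp add: W_def eig)
  qed (simp add: Mn_def)
  \<comment> \<open>Through \<open>P\<close> each matrix entry is a finite combination of real parts
    of terms of complex exponential series, hence summable.\<close>
  have entry: "((1 / fact n) *\<^sub>R Mn n) $ a $ b = (\<Sum>j\<in>UNIV. P $ a $ j * Re (z j ^ n /\<^sub>R fact n * W (axis b 1) j))"
    for n a b
  proof -
    have "Mn n $ a $ b = (Mn n *v axis b 1) $ a"
      by (simp add: matrix_vector_mult_basis column_def)
    also have "\<dots> = (P *v (N *v (Mn n *v axis b 1))) $ a"
      by (simp only: matrix_vector_mul_assoc[of P] PN matrix_vector_mul_lid)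
    also have "\<dots> = (\<Sum>j\<in>UNIV. P $ a $ j * Re (W (Mn n *v axis b 1) j))"
      by (simp add: W_def matrix_vector_mult_def[of P])
    finally have "((1 / fact n) *\<^sub>R Mn n) $ a $ b = (\<Sum>j\<in>UNIV. P $ a $ j * ((1 / fact n) * Re (W (Mn n *v axis b 1) j)))"
      by (simp add: sum_distrib_left mult.left_commute)
    moreover have re: "(1 / fact n) * Re (W (Mn n *v axis b 1) j) = Re (z j ^ n /\<^sub>R fact n * W (axis b 1) j)" for j
      unfolding W_Mn mult_scaleR_left by (simp add: divide_inverse)
    ultimately show ?thesis by (simp only: re)
  qed
  have "summable (\<lambda>n. (1 / fact n) *\<^sub>R Mn n)"
  proof (rule summable_matrix)
    fix a b
    have "summable (\<lambda>n. Re (z j ^ n /\<^sub>R fact n * W (axis b 1) j))" for j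
      by (intro summable_Re summable_mult2 summable_exp_generic)
    then show "summable (\<lambda>n. ((1 / fact n) *\<^sub>R Mn n) $ a $ b)"
      unfolding entry by (intro summable_sum summable_mult)
  qed
  moreover have "bounded_linear (\<lambda>Q. W (Q *v x) i)"
    unfolding linear_conv_bounded_linear[symmetric]
    by (rule linearI)
       (simp_all add: W_def complex_eq_iff matrix_vector_mult_add_rdistrib matrix_vector_right_distrib
         scaleR_matrix_vector_assoc[symmetric] matrix_vector_mult_scaleR)
  ultimately have "W (matrix_exp M *v x) i = (\<Sum>n. W (((1 / fact n) *\<^sub>R Mn n) *v x) i)"
    unfolding matrix_exp_def Mn_def[symmetric] using bounded_linear.suminf by blast
  also have "\<dots> = (\<Sum>n. z i ^ n /\<^sub>R fact n * W x i)"
  proof (rule arg_cong[where f=suminf], rule ext)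
    fix n
    have "W (((1 / fact n) *\<^sub>R Mn n) *v x) i = (1 / fact n) *\<^sub>R W (Mn n *v x) i"
      by (simp add: W_def complex_eq_iff scaleR_matrix_vector_assoc[symmetric] matrix_vector_mult_scaleR)
    then show "W (((1 / fact n) *\<^sub>R Mn n) *v x) i = z i ^ n /\<^sub>R fact n * W x i"
      by (simp add: W_Mn divide_inverse)
  qed
  also have "\<dots> = exp (z i) * W x i"
    unfolding exp_def by (rule suminf_mult2[symmetric]) (rule summable_exp_generic)
  finally show ?thesis by (simp add: W_def)
qed

text \<open>The columns of \<open>P\<close> together with (0, 1) form an orthonormal basis, and
  \<open>N\<close> yields the horizontal coordinates in it.\<close>

lemma adapted_inner_product_eq:
  assumes "inner_product ip" "ip (0, 1) (0, 1) = 1" "\<And>v. ip (0, 1) (v, 0) = 0"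
    and PN: "P ** N = mat 1"
    and on: "\<And>i j. ip (column i P, 0) (column j P, 0) = (if i = j then 1 else 0)"
  shows "ip (u, s) (v, s') = s * s' + (\<Sum>i\<in>UNIV. (N *v u) $ i * (N *v v) $ i)"
proof -
  have lin2: "linear (ip w)" and sym: "ip w w' = ip w' w" for w w'
    using assms(1) unfolding inner_product_def by blast+
  have lin1: "linear (\<lambda>w. ip w w')" for w'
    using lin2[of w'] by (simp add: sym[of _ w'])
  have dec: "(w, r) = (\<Sum>i\<in>UNIV. (N *v w) $ i *\<^sub>R (column i P, 0)) + r *\<^sub>R (0, 1)" for w :: "real^'a" and r :: real
  proof -
    have "w = P *v (N *v w)"
      by (simp add: matrix_vector_mul_assoc PN)
    also have "\<dots> = (\<Sum>i\<in>UNIV. (N *v w) $ i *\<^sub>R column i P)"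
      unfolding matrix_mult_sum scalar_mult_eq_scaleR ..
    finally have w: "w = (\<Sum>i\<in>UNIV. (N *v w) $ i *\<^sub>R column i P)" .
    show ?thesis
      by (rule prod_eqI) (simp_all add: fst_sum snd_sum w[symmetric])
  qed
  have "ip (u, s) (v, s') = (\<Sum>i\<in>UNIV. (N *v u) $ i * ip (column i P, 0) (v, s')) + s * ip (0, 1) (v, s')"
    by (subst dec[of u s])
       (simp only: linear_add[OF lin1] linear_sum[OF lin1] linear_cmul[OF lin1] real_scaleR_def)
  moreover have "ip (column i P, 0) (v, s') = (N *v v) $ i" for i
    by (subst dec[of v s'])
       (simp add: linear_add[OF lin2] linear_sum[OF lin2] linear_cmul[OF lin2] on sym[of _ "(0,1)"] assms(3)
         if_distrib[of "\<lambda>x. _ * x"] del: scaleR_Pair cong: if_cong)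
  moreover have "ip (0, 1) (v, s') = s'"
    by (subst dec[of v s'])
       (simp add: linear_add[OF lin2] linear_sum[OF lin2] linear_cmul[OF lin2] assms(2,3) del: scaleR_Pair)
  ultimately show ?thesis by simp
qed

text \<open>Left translation by (x, t) acts on horizontal vectors by E = exp (t C), so the form at
  (x, t) is the one at the identity, pulled back by the inverse of E. In complex coordinates E
  multiplies by exp (t z_i): its modulus gives the warping factor, and its argument is a rotation
  that drops out within each block.\<close>

lemma adapted_metric_warped:
  fixes C :: "real^'k^'k"
  assumes "adapted_metric C g"
  obtains N P D where "warped_metric g (\<lambda>i. D $ i $ i) N P" "D = N ** C ** P" "real_jordan_block_diagonal D"
proof -
  obtain P :: "real^'k^'k" where inv: "invertible P" and jordan: "real_jordan_block_diagonal (matrix_inv P ** C ** P)"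
    and on: "\<And>i j. g (0, 0) (column i P, 0) (column j P, 0) = (if i = j then 1 else 0)"
    and ip: "inner_product (g (0, 0))" "g (0, 0) (0, 1) (0, 1) = 1" "\<And>v. g (0, 0) (0, 1) (v, 0) = 0"
    using assms unfolding adapted_metric_def adapted_inner_product_def by blast
  define N where "N = matrix_inv P"
  define D where "D = N ** C ** P"
  have NP: "N ** P = mat 1" and PN: "P ** N = mat 1"
    using inv by (simp_all add: N_def matrix_inv_mult)
  obtain \<sigma> z where \<sigma>: "\<And>i. \<sigma> (\<sigma> i) = i" and z: "\<And>i. Re (z i) = D $ i $ i"
    and D\<sigma>: "\<And>i. D $ \<sigma> i $ \<sigma> i = D $ i $ i"
    and W: "\<And>a i. Complex ((D *v a) $ i) ((D *v a) $ \<sigma> i) = z i * Complex (a $ i) (a $ \<sigma> i)"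
    by (rule real_jordan_complex_coordinates[OF jordan[folded N_def, folded D_def]]) (rule that)
  have "g (x, t) (u, s) (v, s') = s * s' + (\<Sum>i\<in>UNIV. exp (- 2 * D $ i $ i * t) * (N *v u) $ i * (N *v v) $ i)"
    for x t u s v s'
  proof -
    define E where "E = matrix_exp (t *\<^sub>R C)"
    have "N *v ((t *\<^sub>R C) *v y) = t *\<^sub>R (D *v (N *v y))" for y
    proof -
      have "D *v (N *v y) = (N ** C ** (P ** N)) *v y"
        by (simp add: D_def matrix_vector_mul_assoc matrix_mul_assoc)
      then show ?thesis
        by (simp add: PN scaleR_matrix_vector_assoc[symmetric] matrix_vector_mult_scaleR matrix_vector_mul_assoc)
    qed
    then have "Complex ((N *v ((t *\<^sub>R C) *v y)) $ i) ((N *v ((t *\<^sub>R C) *v y)) $ \<sigma> i)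
        = (of_real t * z i) * Complex ((N *v y) $ i) ((N *v y) $ \<sigma> i)" for y i
      unfolding mult.assoc W[symmetric] by (simp add: complex_eq_iff)
    from matrix_exp_complex_coordinates[OF PN this]
    have E: "Complex ((N *v (E *v y)) $ i) ((N *v (E *v y)) $ \<sigma> i)
        = exp (of_real t * z i) * Complex ((N *v y) $ i) ((N *v y) $ \<sigma> i)" for y i
      by (simp add: E_def)
    \<comment> \<open>The multipliers exp (t z_i) never vanish; hence every tangent vector at (x, t)
      is the translate of one at the identity.\<close>
    have "inj ((*v) E)"
      unfolding linear_injective_0[OF matrix_vector_mul_linear]
    proof safe
      fix y assume Ey: "E *v y = 0"
      have "exp (of_real t * z i) * Complex ((N *v y) $ i) ((N *v y) $ \<sigma> i) = 0" for i
        unfolding E[symmetric] by (simp add: Ey Complex_eq_0)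
      then have "Complex ((N *v y) $ i) ((N *v y) $ \<sigma> i) = 0" for i
        by simp
      then have "N *v y = 0" by (simp add: vec_eq_iff Complex_eq_0)
      then have "P *v (N *v y) = 0" by simp
      then show "y = 0" by (simp add: matrix_vector_mul_assoc PN)
    qed
    then have "surj ((*v) E)"
      by (simp add: linear_injective_imp_surjective)
    then obtain u0 v0 where u0: "u = E *v u0" and v0: "v = E *v v0"
      by (metis surjD)
    have "G_mult C (x, t) = (\<lambda>q. (x + E *v fst q, t + snd q))"
      by (auto simp: G_mult_def E_def)
    moreover have "((\<lambda>q. (x + E *v fst q, t + snd q)) has_derivative (\<lambda>q. (E *v fst q, snd q))) (at (0, 0))"
      by (auto intro!: derivative_eq_intros bounded_linear.has_derivative[OF matrix_vector_mul_bounded_linear])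
    ultimately have deriv: "frechet_derivative (G_mult C (x, t)) (at (0, 0)) = (\<lambda>q. (E *v fst q, snd q))"
      by (simp add: frechet_derivative_at[symmetric])
    have "g (G_mult C (x, t) (0, 0)) (frechet_derivative (G_mult C (x, t)) (at (0, 0)) (u0, s))
        (frechet_derivative (G_mult C (x, t)) (at (0, 0)) (v0, s')) = g (0, 0) (u0, s) (v0, s')"
      using assms unfolding adapted_metric_def left_invariant_def by blast
    then have "g (x, t) (u, s) (v, s') = g (0, 0) (u0, s) (v0, s')"
      unfolding deriv by (simp add: G_mult_def u0 v0)
    also have "\<dots> = s * s' + (\<Sum>i\<in>UNIV. (N *v u0) $ i * (N *v v0) $ i)"
      by (rule adapted_inner_product_eq[OF ip PN on])
    also have "(\<Sum>i\<in>UNIV. (N *v u0) $ i * (N *v v0) $ i)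
        = (\<Sum>i\<in>UNIV. exp (- 2 * D $ i $ i * t) * (N *v u) $ i * (N *v v) $ i)" (is "sum ?f _ = sum ?h _")
    proof -
      \<comment> \<open>A single coordinate need not scale by itself; the sum over \<open>i\<close>
        and \<open>\<sigma> i\<close> does, being the real part of a Hermitian product. At a fixed
        index both sides are merely doubled.\<close>
      have pair: "?f i + ?f (\<sigma> i) = ?h i + ?h (\<sigma> i)" for i
      proof -
        let ?w = "\<lambda>y. Complex ((N *v y) $ i) ((N *v y) $ \<sigma> i)"
        have "?h i + ?h (\<sigma> i) = exp (- 2 * D $ i $ i * t) * Re (?w u * cnj (?w v))"
          by (simp add: D\<sigma> algebra_simps)
        also have "?w u * cnj (?w v) = (exp (of_real t * z i) * cnj (exp (of_real t * z i))) * (?w u0 * cnj (?w v0))"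
          unfolding u0 v0 E by simp
        also have "exp (of_real t * z i) * cnj (exp (of_real t * z i)) = of_real (exp (2 * D $ i $ i * t))"
          unfolding complex_norm_square[symmetric] norm_exp_eq_Re
          by (simp add: z power2_eq_square exp_add[symmetric] algebra_simps)
        also have "exp (- 2 * D $ i $ i * t) * Re (of_real (exp (2 * D $ i $ i * t)) * (?w u0 * cnj (?w v0)))
            = Re (?w u0 * cnj (?w v0))"
        proof -
          have "exp (- c) * Re (of_real (exp c) * w) = Re w" for c :: real and w :: complex
            by (simp add: exp_minus)
          then show ?thesis by (metis mult_minus_left)
        qed
        also have "\<dots> = ?f i + ?f (\<sigma> i)" by simp
        finally show ?thesis by simp
      qed
      have "bij \<sigma>" using \<sigma> by (metis involuntory_imp_bij)
      then have "sum ?f UNIV = sum (\<lambda>i. ?f (\<sigma> i)) UNIV" "sum ?h UNIV = sum (\<lambda>i. ?h (\<sigma> i)) UNIV"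
        by (auto intro: sum.reindex_bij_betw[symmetric])
      \<comment> \<open>Summing the pairs over all indices counts every index twice on both
        sides.\<close>
      moreover have "sum ?f UNIV + sum (\<lambda>i. ?f (\<sigma> i)) UNIV = sum ?h UNIV + sum (\<lambda>i. ?h (\<sigma> i)) UNIV"
        unfolding sum.distrib[symmetric] by (rule sum.cong) (auto simp only: pair)
      ultimately show ?thesis by linarith
    qed
    finally show ?thesis .
  qed
  then have "warped_metric g (\<lambda>i. D $ i $ i) N P"
    by unfold_locales (auto simp: NP)
  then show thesis
    using that D_def jordan N_def by blast
qed

section \<open>Volume entropy of the horospherical product\<close>

text \<open>Rows \<open>i\<close> and \<open>\<sigma> i\<close> of \<open>Y\<close> form a complex
  row vector that is a left eigenvector of \<open>A\<close> for the multiplier of the block. So the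
  diagonal of \<open>D\<close> shows real parts of eigenvalues without any comparison of normal
  forms. \<open>Y\<close> may be rectangular, as the horospherical case requires.\<close>

lemma intertwiner_row_eigenvalue:
  fixes D :: "real^'k^'k" and Y :: "real^'n^'k" and A :: "real^'n^'n"
  assumes "real_jordan_block_diagonal D" and DY: "D ** Y = Y ** A" and Y: "Y $ i $ j \<noteq> 0"
  shows "\<exists>z. complex_eigenvalue A z \<and> Re z = D $ i $ i"
proof -
  obtain \<sigma> \<zeta> where \<zeta>: "\<And>i. Re (\<zeta> i) = D $ i $ i"
    and W: "\<And>a i. Complex ((D *v a) $ i) ((D *v a) $ \<sigma> i) = \<zeta> i * Complex (a $ i) (a $ \<sigma> i)"
    by (rule real_jordan_complex_coordinates[OF assms(1)]) (rule that)
  define \<eta> :: "complex^'n" where "\<eta> = (\<chi> j. Complex (Y $ i $ j) (Y $ \<sigma> i $ j))"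
  define M where "M = complexify A - mat (\<zeta> i)"
  have "\<eta> \<noteq> 0"
    using Y by (auto simp: \<eta>_def vec_eq_iff Complex_eq_0)
  have "(\<eta> v* M) $ j = 0" for j
  proof -
    have col: "(D *v column j Y) $ l = (\<Sum>m\<in>UNIV. Y $ l $ m * A $ m $ j)" for l
    proof -
      have "(D *v column j Y) $ l = (D ** Y) $ l $ j"
        by (simp add: matrix_vector_mult_def matrix_matrix_mult_def column_def)
      then show ?thesis unfolding DY by (simp add: matrix_matrix_mult_def)
    qed
    have "(\<eta> v* complexify A) $ j = Complex ((D *v column j Y) $ i) ((D *v column j Y) $ \<sigma> i)"
      by (simp add: vector_matrix_mult_def \<eta>_def col complex_eq_iff map_matrix_def mult.commute)
    also have "\<dots> = \<zeta> i * \<eta> $ j"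
      unfolding W by (simp add: \<eta>_def column_def)
    finally show ?thesis
      by (simp add: M_def vector_matrix_mult_def right_diff_distrib sum_subtractf mat_def
          if_distrib[of "\<lambda>x. _ * x"] cong: if_cong)
  qed
  then have \<eta>M: "\<eta> v* M = 0" by (simp add: vec_eq_iff)
  \<comment> \<open>A square matrix that annihilates a nonzero row vector is singular, so it also
    annihilates a column vector.\<close>
  have "\<exists>v. M *v v = 0 \<and> v \<noteq> 0"
  proof (rule ccontr)
    assume "\<nexists>v. M *v v = 0 \<and> v \<noteq> 0"
    then obtain M' where "M' ** M = mat 1"
      using matrix_left_invertible_ker[of M] by blast
    then have "M ** M' = mat 1" using matrix_left_right_inverse by blast
    then have "\<eta> = (\<eta> v* M) v* M'"
      by (simp add: vector_matrix_mul_assoc)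
    then show False using \<eta>M \<open>\<eta> \<noteq> 0\<close> by simp
  qed
  then obtain v where "M *v v = 0" "v \<noteq> 0" by blast
  moreover have "mat (\<zeta> i) *v v = \<zeta> i *s v"
    by (simp add: vec_eq_iff matrix_vector_mult_def mat_def if_distrib[of "\<lambda>x. x * _"] cong: if_cong)
  ultimately have "complex_eigenvalue A (\<zeta> i)"
    by (auto simp: complex_eigenvalue_def M_def matrix_vector_mult_diff_rdistrib)
  then show ?thesis using \<zeta> by blast
qed

lemma complex_eigenvalue_uminus:
  assumes "complex_eigenvalue (- B) z"
  shows "complex_eigenvalue B (- z)"
proof -
  obtain v where v: "v \<noteq> 0" "complexify (- B) *v v = z *s v"
    using assms by (auto simp: complex_eigenvalue_def)
  have "(complexify B *v v) $ i = (- z *s v) $ i" for i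
    using arg_cong[OF v(2), of "\<lambda>x. - (x $ i)"]
    by (simp add: matrix_vector_mult_def map_matrix_def sum_negf)
  then show ?thesis
    using v(1) by (auto simp: complex_eigenvalue_def vec_eq_iff)
qed

lemma trace_similar:
  fixes A J P Q :: "'a::comm_ring_1^'n^'n"
  assumes "A = P ** J ** Q" "Q ** P = mat 1"
  shows "trace A = trace J"
proof -
  have "trace A = trace (Q ** (P ** J))"
    unfolding assms(1) by (rule trace_mul_sym)
  then show ?thesis by (simp add: matrix_mul_assoc assms(2))
qed

lemma trace_complex_jordan_form:
  assumes "complex_jordan_form_of A J"
  shows "trace J = complex_of_real (trace A)"
proof -
  obtain P :: "complex^'a^'a" where "invertible P" "complexify A = P ** J ** matrix_inv P"
    using assms by (auto simp: complex_jordan_form_of_def)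
  then have "trace (complexify A) = trace J"
    using trace_similar matrix_inv_mult by blast
  then show ?thesis by (simp add: trace_def map_matrix_def)
qed

text \<open>\<open>N\<close> intertwines \<open>D\<close> with \<open>A\<close> and has no zero row,
  so every diagonal entry of \<open>D\<close> is the real part of an eigenvalue of \<open>A\<close>.
  Positivity then makes \<open>pos_sum\<close> the trace and \<open>neg_sum\<close> zero.\<close>

lemma heintze_volume_entropy:
  fixes A :: "real^'n^'n"
  assumes "adapted_metric A g" and pos: "\<And>z. complex_eigenvalue A z \<Longrightarrow> Re z > 0"
  shows "has_volume_entropy g (trace A)"
proof -
  obtain N P D where w: "warped_metric g (\<lambda>i. D $ i $ i) N P" and D: "D = N ** A ** P"
    and jordan: "real_jordan_block_diagonal D"
    using adapted_metric_warped[OF assms(1)] .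
  interpret warped_metric g "\<lambda>i. D $ i $ i" N P by fact
  have DN: "D ** N = N ** A"
    unfolding D by (simp add: matrix_mul_assoc[symmetric] PN)
  have D_pos: "D $ i $ i > 0" for i
  proof -
    have "(N ** P) $ i $ i = 0" if "\<forall>j. N $ i $ j = 0"
      using that by (simp add: matrix_matrix_mult_def)
    then obtain j where "N $ i $ j \<noteq> 0"
      by (auto simp: NP mat_def)
    then obtain z where "complex_eigenvalue A z" "Re z = D $ i $ i"
      using intertwiner_row_eigenvalue[OF jordan DN] by blast
    then show ?thesis using pos by metis
  qed
  have "trace D = trace A"
    using trace_similar[OF D] PN by blast
  moreover have "max (D $ i $ i) 0 = D $ i $ i" "max (- D $ i $ i) 0 = 0" for i
    using D_pos[of i] by simp_all
  then have "pos_sum = trace D" "neg_sum = 0"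
    by (simp_all add: pos_sum_def neg_sum_def trace_def)
  moreover have "trace D \<ge> 0"
    unfolding trace_def by (intro sum_nonneg less_imp_le D_pos)
  ultimately have "entropy = trace A"
    by (simp add: entropy_def)
  then show ?thesis using has_volume_entropy by simp
qed

lemma sum_sum_type: "(\<Sum>k\<in>UNIV. f k) = (\<Sum>a\<in>UNIV. f (Inl a)) + (\<Sum>b\<in>UNIV. f (Inr b))"
  for f :: "'n::finite + 'm::finite \<Rightarrow> 'a::comm_monoid_add"
  by (simp add: UNIV_Plus_UNIV[symmetric] sum.Plus del: UNIV_Plus_UNIV)

text \<open>The two column blocks of \<open>N\<close> intertwine \<open>D\<close> with A and with
  -B. By the signs of the real parts, a row of the first block vanishes if its diagonal entry in
  \<open>D\<close> is at most 0, and a row of the second if it is at least 0, so that each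
  coordinate belongs to one summand.\<close>

lemma horospherical_volume_entropy:
  fixes A :: "real^'n^'n" and B :: "real^'m^'m"
  assumes "adapted_metric (horospherical_matrix A B) g"
    and posA: "\<And>z. complex_eigenvalue A z \<Longrightarrow> Re z > 0"
    and posB: "\<And>z. complex_eigenvalue B z \<Longrightarrow> Re z > 0"
  shows "has_volume_entropy g (max (trace A) (trace B))"
proof -
  define C where "C = horospherical_matrix A B"
  have C: "C $ Inl a $ Inl a' = A $ a $ a'" "C $ Inr b $ Inr b' = - B $ b $ b'"
    "C $ Inl a $ Inr b = 0" "C $ Inr b $ Inl a = 0" for a a' b b'
    by (simp_all add: C_def horospherical_matrix_def block_diag_def)
  obtain N P D where w: "warped_metric g (\<lambda>i. D $ i $ i) N P" and D: "D = N ** C ** P"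
    and jordan: "real_jordan_block_diagonal D"
    using adapted_metric_warped[OF assms(1)[folded C_def]] .
  interpret warped_metric g "\<lambda>i. D $ i $ i" N P by fact
  have DN: "D ** N = N ** C"
    unfolding D by (simp add: matrix_mul_assoc[symmetric] PN)
  define YA :: "real^'n^('n + 'm)" where "YA = (\<chi> i a. N $ i $ Inl a)"
  define YB :: "real^'m^('n + 'm)" where "YB = (\<chi> i b. N $ i $ Inr b)"
  have NCl: "(N ** C) $ i $ Inl a = (YA ** A) $ i $ a" for i a
    by (simp add: matrix_matrix_mult_def YA_def sum_sum_type C)
  have NCr: "(N ** C) $ i $ Inr b = (YB ** (- B)) $ i $ b" for i b
    by (simp add: matrix_matrix_mult_def YB_def sum_sum_type C)
  have "(D ** YA) $ i $ a = (YA ** A) $ i $ a" for i a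
    unfolding NCl[symmetric] DN[symmetric] by (simp add: matrix_matrix_mult_def YA_def)
  then have DYA: "D ** YA = YA ** A" by (simp add: vec_eq_iff)
  have "(D ** YB) $ i $ b = (YB ** (- B)) $ i $ b" for i b
    unfolding NCr[symmetric] DN[symmetric] by (simp add: matrix_matrix_mult_def YB_def)
  then have DYB: "D ** YB = YB ** (- B)" by (simp add: vec_eq_iff)
  have YA0: "YA $ i $ a = 0" if "D $ i $ i \<le> 0" for i a
    using intertwiner_row_eigenvalue[OF jordan DYA] posA that by (metis not_le)
  have YB0: "YB $ i $ b = 0" if "D $ i $ i \<ge> 0" for i b
  proof (rule ccontr)
    assume "YB $ i $ b \<noteq> 0"
    then obtain z where "complex_eigenvalue (- B) z" "Re z = D $ i $ i"
      using intertwiner_row_eigenvalue[OF jordan DYB] by blast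
    then show False
      using posB[OF complex_eigenvalue_uminus] that by fastforce
  qed
  \<comment> \<open>These are the contributions of the two summands to the diagonal of N C P. Since
    one of them always vanishes, they are the positive and the negative part of the entry.\<close>
  let ?a = "\<lambda>i. \<Sum>a\<in>UNIV. (N ** C) $ i $ Inl a * P $ Inl a $ i"
  let ?b = "\<lambda>i. \<Sum>b\<in>UNIV. (N ** C) $ i $ Inr b * P $ Inr b $ i"
  have Dii: "D $ i $ i = ?a i + ?b i" for i
    by (simp add: D matrix_matrix_mult_def[of "N ** C"] sum_sum_type)
  have a0: "?a i = 0" if "D $ i $ i \<le> 0" for i
    unfolding NCl by (simp add: matrix_matrix_mult_def YA0[OF that])
  have b0: "?b i = 0" if "D $ i $ i \<ge> 0" for i
    unfolding NCr by (simp add: matrix_matrix_mult_def YB0[OF that])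
  have "max (D $ i $ i) 0 = ?a i \<and> max (- D $ i $ i) 0 = - ?b i" for i
  proof (cases "D $ i $ i \<ge> 0")
    case True
    then have "?a i = D $ i $ i" using Dii[of i] b0[OF True] by linarith
    then show ?thesis unfolding b0[OF True] using True by (simp only: max_def) simp
  next
    case False
    then have neg: "D $ i $ i \<le> 0" by simp
    then have "?b i = D $ i $ i" using Dii[of i] a0[OF neg] by linarith
    then show ?thesis unfolding a0[OF neg] using neg by (simp only: max_def) simp
  qed
  then have max_a: "\<And>i. max (D $ i $ i) 0 = ?a i" and max_b: "\<And>i. max (- D $ i $ i) 0 = - ?b i"
    by blast+
  have PNC: "(\<Sum>i\<in>UNIV. (N ** C) $ i $ k * P $ k $ i) = C $ k $ k" for k
  proof -
    have "(\<Sum>i\<in>UNIV. (N ** C) $ i $ k * P $ k $ i) = (P ** (N ** C)) $ k $ k"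
      by (simp add: matrix_matrix_mult_def[of P] mult.commute)
    then show ?thesis by (simp add: matrix_mul_assoc PN)
  qed
  \<comment> \<open>Exchanging the sums turns the contributions of the first summand into diagonal
    entries of P N C = C in the first block, that is, of A.\<close>
  have "pos_sum = (\<Sum>a\<in>UNIV. \<Sum>i\<in>UNIV. (N ** C) $ i $ Inl a * P $ Inl a $ i)"
    unfolding pos_sum_def max_a by (rule sum.swap)
  then have "pos_sum = trace A"
    by (simp add: PNC C trace_def)
  moreover have "neg_sum = - (\<Sum>b\<in>UNIV. \<Sum>i\<in>UNIV. (N ** C) $ i $ Inr b * P $ Inr b $ i)"
    unfolding neg_sum_def max_b sum_negf by (subst sum.swap) simp
  then have "neg_sum = trace B"
    by (simp add: PNC C trace_def sum_negf)
  ultimately show ?thesis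
    using has_volume_entropy by (simp add: entropy_def)
qed

text \<open>\<open>volume_entropy\<close> is a definite description, so the conclusion also asserts
  that the three limits exist. The adapted metrics are arbitrary, which makes the entropies
  independent of the chosen bases.\<close>

theorem corollary4:
  fixes A :: "real^'n^'n" and B :: "real^'m^'m"
    and JA :: "complex^'n^'n" and JB :: "complex^'m^'m"
    and gA :: "'n metric_field" and gB :: "'m metric_field" and gAB :: "('n + 'm) metric_field"
  assumes "diagonalizable_over_complex A" and "diagonalizable_over_complex B"
    and "\<And>z. complex_eigenvalue A z \<Longrightarrow> Re z > 0"
    and "\<And>z. complex_eigenvalue B z \<Longrightarrow> Re z > 0"
    and "complex_jordan_form_of A JA" and "complex_jordan_form_of B JB"
    and "adapted_metric A gA" and "adapted_metric B gB"
    and "adapted_metric (horospherical_matrix A B) gAB"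
  shows "has_volume_entropy gA (volume_entropy gA)
       \<and> has_volume_entropy gB (volume_entropy gB)
       \<and> has_volume_entropy gAB (volume_entropy gAB)
       \<and> volume_entropy gAB = max (volume_entropy gA) (volume_entropy gB)
       \<and> complex_of_real (volume_entropy gA) = trace JA
       \<and> complex_of_real (volume_entropy gB) = trace JB"
proof -
  have A: "has_volume_entropy gA (trace A)" and B: "has_volume_entropy gB (trace B)"
    and AB: "has_volume_entropy gAB (max (trace A) (trace B))"
    using assms heintze_volume_entropy horospherical_volume_entropy by blast+
  then show ?thesis
    using trace_complex_jordan_form[OF assms(5)] trace_complex_jordan_form[OF assms(6)]
    by (simp add: volume_entropy_eq[OF A] volume_entropy_eq[OF B] volume_entropy_eq[OF AB])
qed

end
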